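(* Let $\mathbf{B}\in\mathbb{C}^{n\times n}$ be diagonalisable with simple eigenvalues. Assume that every eigenvalue of $\mathbf{B}$ lies in $\mathcal{N}\cup\mathcal{H}$, where $\mathcal{N}\subset\mathbb{C}$ is a bounded open set containing $0$ and $\mathcal{H}$ is a closed half-plane not containing $0$; taking (as the statement does without loss of generality) $\mathcal{H}=\{z\in\mathbb{C}:\ \mathrm{Re}\, z\geq S\}$ for some $S>0$, assume that $\mathcal{H}$ contains at least one eigenvalue of $\mathbf{B}$, so that $S\leq\|\mathbf{B}\|_2$. Let $\lambda_1,\ldots,\lambda_\ell$ be the eigenvalues of $\mathbf{B}$ lying in $\mathcal{N}$, and let $\kappa^*$ be the maximum of the eigenvalue condition numbers $\kappa(\lambda)$ over all eigenvalues $\lambda$ of $\mathbf{B}$. Given $L_0,L_1$ with $0<L_0<L_1\leq S$, let $$N_{\rm eig}:=\big|\{j\in\{1,\dots,\ell\}:\ \lambda_j\in\{L_0<\mathrm{Re}\,z<L_1\}\cap\mathcal{N}\}\big|+1,\qquad \delta:=\frac{L_1-L_0}{4n\,\kappa^*\,N_{\rm eig}}.$$ Let $\beta\in(0,\pi/2)$ be defined by $\cos\beta=\dfrac{L_0}{\|\mathbf{B}\|_2+\delta}$ and let $$\gamma_\beta:=2\sin\Big(\frac{\beta}{4-2\beta/\pi}\Big)\ (<1).$$ Then, when GMRES is applied to $\mathbf{B}\mathbf{x}=\mathbf{b}$ with any $\mathbf{b}\in\mathbb{C}^n$ and initial guess $\mathbf{x}_0\in\mathbb{C}^n$, the $m$th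 GMRES residual satisfies $$\frac{\|\mathbf{r}_m(\mathbf{B},\mathbf{b},\mathbf{x}_0)\|_2}{\|\mathbf{r}_0(\mathbf{B},\mathbf{b},\mathbf{x}_0)\|_2}\leq\Big(\prod_{j=1}^\ell\frac{1}{|\lambda_j|}\Big)(\|\mathbf{B}\|_2+\delta)^{\ell+1}\,3^{\ell+1}\,\delta^{-1}\,\gamma_\beta^{\,m-\ell}.$$
   Context: $\|\cdot\|_2$ denotes the Euclidean vector norm and the induced matrix (spectral) norm. For a simple eigenvalue $\lambda$ of $\mathbf{B}$ with right eigenvector $\mathbf{u}$ and left eigenvector $\mathbf{v}$, its eigenvalue condition number is $\kappa(\lambda):=\|\mathbf{u}\|\|\mathbf{v}\|/|\mathbf{u}\cdot\mathbf{v}|$ (so $\kappa(\lambda)\ge 1$). GMRES: given $\mathbf{x}_0$, let $\mathbf{r}_0:=\mathbf{b}-\mathbf{B}\mathbf{x}_0$ and $\mathcal{K}_m(\mathbf{B},\mathbf{r}_0):=\mathrm{span}\{\mathbf{r}_0,\mathbf{B}\mathbf{r}_0,\dots,\mathbf{B}^{m-1}\mathbf{r}_0\}$; the $m$th iterate $\mathbf{x}_m$ is the vector in $\mathbf{x}_0+\mathcal{K}_m(\mathbf{B},\mathbf{r}_0)$ minimising $\|\mathbf{b}-\mathbf{B}\mathbf{x}_m\|_2$, and $\mathbf{r}_m:=\mathbf{b}-\mathbf{B}\mathbf{x}_m$. Equivalently $\|\mathbf{r}_m\|_2=\min\{\|p(\mathbf{B})\mathbf{r}_0\|_2:\ p$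 a polynomial of degree $\le m$ with $p(0)=1\}$. *)

theory Defs
  imports "HOL-Analysis.Analysis" "HOL-Computational_Algebra.Polynomial"
begin

definition eigenvalues :: "complex ^ 'n ^ 'n \<Rightarrow> complex set" where
  "eigenvalues B = {z. \<exists>v. v \<noteq> 0 \<and> B *v v = z *s v}"

definition simple_eigenvalue :: "complex ^ 'n ^ 'n \<Rightarrow> complex \<Rightarrow> bool" where
  "simple_eigenvalue B \<mu> \<longleftrightarrow> \<mu> \<in> eigenvalues B \<and>
     (\<exists>p. (\<forall>x. poly p x = det (mat x - B)) \<and> order \<mu> p = 1)"

definition diagonalisable :: "complex ^ 'n ^ 'n \<Rightarrow> bool" where
  "diagonalisable B \<longleftrightarrow> (\<exists>(P :: complex ^ 'n ^ 'n) (D :: complex ^ 'n ^ 'n). invertible P \<and> (\<forall>i j. i \<noteq> j \<longrightarrow> D $ i $ j = 0) \<and>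
      B = P ** D ** matrix_inv P)"

definition spec_norm :: "complex ^ 'n ^ 'n \<Rightarrow> real" where
  "spec_norm B = onorm (\<lambda>x. B *v x)"

text \<open>Eigenvalue condition number ||u|| ||v|| / |v . u| with u a right and v a left
  eigenvector (v^T B = lambda v^T). For a simple eigenvalue this does not depend on
  the choice of u and v.\<close>
definition eig_cond :: "complex ^ 'n ^ 'n \<Rightarrow> complex \<Rightarrow> real" where
  "eig_cond B \<mu> = (SOME k. \<exists>u v. u \<noteq> 0 \<and> v \<noteq> 0 \<and> B *v u = \<mu> *s u \<and> v v* B = \<mu> *s v \<and>
      k = norm u * norm v / cmod (\<Sum>i\<in>UNIV. u $ i * v $ i))"

definition krylov_vec :: "complex ^ 'n ^ 'n \<Rightarrow> complex ^ 'n \<Rightarrow> nat \<Rightarrow> complex ^ 'n" where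
  "krylov_vec B r k = ((\<lambda>x. B *v x) ^^ k) r"

text \<open>Norm of the m-th GMRES residual: minimum of ||b - B x|| over x in x0 + K_m(B, r0),
  r0 = b - B x0 (the minimum is attained; we take the infimum).\<close>
definition gmres_res_norm ::
  "complex ^ 'n ^ 'n \<Rightarrow> complex ^ 'n \<Rightarrow> complex ^ 'n \<Rightarrow> nat \<Rightarrow> real" where
  "gmres_res_norm B b x0 m =
     Inf {norm (b - B *v x) | x. \<exists>c :: nat \<Rightarrow> complex.
            x = x0 + (\<Sum>k<m. c k *s krylov_vec B (b - B *v x0) k)}"

end

(*
  B acts on the residual through the spectral projections, whose norms are the eigenvalue
  condition numbers, so it suffices to find a polynomial p of degree at most m with p(0) = 1
  that is small on the spectrum. Take p(z) = q(z/R) times the product of the 1 - z/lambda_j over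
  the eigenvalues in N, where R = |B| + delta. Then q only has to be small on the lens
  |z| < 1, Re z > cos(beta).

  Let Psi map the exterior of the unit disc conformally onto the exterior of the lens, fixing
  infinity. The Faber polynomials of the lens are the coefficients of w^(-k) in
  h_z(w) = w Psi'(w) / (Psi(w) - z), and on |w| = 1 the lens being starlike about z gives
  Re h_z >= 0. The coefficients of h_z - h_0 + w / (w - zeta), where Psi(zeta) = 0, are again
  polynomials in z, equal to zeta^k at z = 0. On |w| = 1 the real part of this function is
  dominated by that of a function with mean 4, so its coefficients are at most 8.
  Dividing by zeta^k gives q with |q| <= 8 gamma^k, as |zeta| = 1 / gamma.
*)

theory Submission
  imports Defs "HOL-Complex_Analysis.Complex_Analysis"
begin

section \<open>Coefficient estimates\<close>

text \<open>The obstacle is the normalisation at 0, a point outside the lens. The value of the k-th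
  Faber polynomial at 0 is the main term \<open>zeta^k\<close> plus a contribution from the part of
  \<open>h_0\<close> that stays regular in the exterior of the disc. Replacing \<open>h_0\<close> by
  its pole term alone removes this contribution exactly, so nothing has to be bounded from below.
  The price is that \<open>h_0\<close> enters the estimate, and on the chord its real part can be
  very negative when the chord is close to 0. Only a one-sided bound is available,
  \<open>Re h_0 \<le> 2 * Re h_z\<close>, but it suffices: a coefficient is controlled by the mean
  of a majorant of the real part, and the mean of the regular part of \<open>h_0\<close> is known.
  The constants combine as follows. The definition of \<delta> gives
  \<open>n * \<kappa> \<le> R / (4 * \<delta>)\<close>, so the 8 of the lens and the sum over the
  spectral projections together cost \<open>2 * R / \<delta>\<close>. Each deflated eigenvalue costs
  a further \<open>2 * R / |lambda|\<close>. The resulting \<open>2 ^ (l + 1)\<close> lies below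
  \<open>3 ^ (l + 1)\<close>.\<close>

lemma circle_integral_mult_power:
  assumes "continuous_on (cball 0 1) f" "f holomorphic_on ball 0 1"
  shows "((\<lambda>t. f (cis (2*pi*t)) * cis (2*pi*t) ^ k) has_integral f 0 * 0 ^ k) {0..1}"
proof -
  have "((\<lambda>u. (f u * u ^ k) / (u - 0)) has_contour_integral
      (2 * of_real pi * \<i> * (f 0 * 0 ^ k))) (circlepath 0 1)"
    using assms by (intro Cauchy_integral_circlepath continuous_intros holomorphic_intros) auto
  then have "((\<lambda>t. 2 * of_real pi * \<i> * (f (cis (2*pi*t)) * cis (2*pi*t) ^ k)) has_integral
      (2 * of_real pi * \<i> * (f 0 * 0 ^ k))) {0..1}"
    unfolding has_contour_integral_def
    by (rule has_integral_eq[rotated])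
       (simp add: vector_derivative_circlepath01, simp add: circlepath cis_conv_exp mult_ac)
  from has_integral_mult_right[OF this, of "1 / (2 * of_real pi * \<i>)"]
  show ?thesis by (simp add: mult.commute)
qed

lemma circle_integral_div_power:
  assumes "continuous_on (cball 0 1) f" "f holomorphic_on ball 0 1"
  shows "((\<lambda>t. f (cis (2*pi*t)) / cis (2*pi*t) ^ k) has_integral
           (deriv ^^ k) f 0 / fact k) {0..1}"
proof -
  have "((\<lambda>u. f u / (u - 0) ^ Suc k) has_contour_integral
      ((2 * pi * \<i>) / fact k * (deriv ^^ k) f 0)) (circlepath 0 1)"
    using assms by (intro Cauchy_has_contour_integral_higher_derivative_circlepath) auto
  then have "((\<lambda>t. 2 * of_real pi * \<i> * (f (cis (2*pi*t)) / cis (2*pi*t) ^ k)) has_integral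
      ((2 * pi * \<i>) / fact k * (deriv ^^ k) f 0)) {0..1}"
    unfolding has_contour_integral_def
    by (rule has_integral_eq[rotated])
       (simp add: vector_derivative_circlepath01, simp add: circlepath cis_conv_exp mult_ac)
  from has_integral_mult_right[OF this, of "1 / (2 * of_real pi * \<i>)"]
  show ?thesis by simp
qed

text \<open>The conjugate of \<^term>\<open>f\<close> contributes nothing to a coefficient of positive
  index, so the coefficient is an integral of the real part.\<close>

lemma coeff_le_of_Re_le:
  assumes f: "continuous_on (cball 0 1) f" "f holomorphic_on ball 0 1"
    and g: "continuous_on (cball 0 1) g" "g holomorphic_on ball 0 1"
    and le: "\<And>u. norm u = 1 \<Longrightarrow> \<bar>Re (f u)\<bar> \<le> Re (g u)"
    and k: "k > 0"
  shows "norm ((deriv ^^ k) f 0 / fact k) \<le> 2 * Re (g 0)"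
proof -
  define e where "e t = cis (2*pi*t)" for t
  have "((\<lambda>t. f (e t) * e t ^ k) has_integral 0) {0..1}"
    using circle_integral_mult_power[OF f, of k] k unfolding e_def by (simp add: zero_power)
  then have "((\<lambda>t. cnj (f (e t) * e t ^ k)) has_integral 0) {0..1}"
    by (auto dest: has_integral_linear[OF _ bounded_linear_cnj] simp only: o_def complex_cnj_zero)
  then have 1: "((\<lambda>t. cnj (f (e t)) / e t ^ k) has_integral 0) {0..1}"
    by (simp add: e_def cis_cnj cis_inverse power_inverse divide_inverse flip: cis_inverse)
  from has_integral_add[OF circle_integral_div_power[OF f, of k, folded e_def] 1]
  have 2: "((\<lambda>t. of_real (2 * Re (f (e t))) / e t ^ k) has_integral (deriv ^^ k) f 0 / fact k) {0..1}"
    by (simp add: complex_add_cnj flip: add_divide_distrib)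
  have "((\<lambda>t. g (e t)) has_integral g 0) {0..1}"
    using circle_integral_mult_power[OF g, of 0] by (simp add: e_def)
  then have "((\<lambda>t. Re (g (e t))) has_integral Re (g 0)) {0..1}"
    by (rule has_integral_Re)
  then have 3: "((\<lambda>t. 2 * Re (g (e t))) has_integral 2 * Re (g 0)) {0..1}"
    by (rule has_integral_mult_right)
  have "norm (of_real (2 * Re (f (e t))) / e t ^ k) \<le> 2 * Re (g (e t))" for t
    using le[of "e t"] by (simp add: e_def norm_divide norm_power norm_mult)
  then have "norm (integral {0..1} (\<lambda>t. of_real (2 * Re (f (e t))) / e t ^ k)) \<le>
       integral {0..1} (\<lambda>t. 2 * Re (g (e t)))"
    using 2 3 by (intro integral_norm_bound_integral) (auto simp: integrable_on_def)
  then show ?thesis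
    by (simp only: integral_unique[OF 2] integral_unique[OF 3])
qed

text \<open>Comparing k-th coefficients is a recursion for \<open>fps_nth g k\<close>. Since
  \<open>A1\<close> has no constant term, its divisor \<open>fps_nth A0 0\<close> is free of
  \<open>z\<close>, so the solution is polynomial and not merely rational in \<open>z\<close>. Each
  earlier coefficient is multiplied by a factor linear in \<open>z\<close>, which raises the degree
  by at most one; the missing constant term of \<open>C1\<close> starts the degrees at 0.\<close>

lemma fps_coeff_poly:
  fixes A0 A1 C0 C1 :: "'a :: field fps"
  assumes "fps_nth A0 0 \<noteq> 0" "fps_nth A1 0 = 0" "fps_nth C1 0 = 0"
  shows "\<exists>Q. degree Q \<le> k \<and> (\<forall>z g. g * (A0 - fps_const z * A1) = C0 - fps_const z * C1
           \<longrightarrow> fps_nth g k = poly Q z)"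
proof (induction k rule: less_induct)
  case (less k)
  then obtain Q where Q: "\<And>i. i < k \<Longrightarrow> degree (Q i) \<le> i"
    "\<And>i z g. i < k \<Longrightarrow> g * (A0 - fps_const z * A1) = C0 - fps_const z * C1 \<Longrightarrow> fps_nth g i = poly (Q i) z"
    by metis
  define P where "P = smult (1 / (fps_nth A0 0)) ([:fps_nth C0 k, - fps_nth C1 k:] -
     (\<Sum>i<k. Q i * [:fps_nth A0 (k - i), - fps_nth A1 (k - i):]))"
  have "degree [:fps_nth C0 k, - fps_nth C1 k:] \<le> k"
    using assms(3) by (cases k) auto
  moreover have "degree (Q i * [:fps_nth A0 (k - i), - fps_nth A1 (k - i):]) \<le> k" if "i < k" for i
  proof -
    have "degree (Q i * [:fps_nth A0 (k - i), - fps_nth A1 (k - i):]) \<le> i + 1"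
      using Q(1)[OF that] by (intro order.trans[OF degree_mult_le]) (auto intro: add_mono)
    then show ?thesis using that by simp
  qed
  ultimately have "degree P \<le> k"
    unfolding P_def by (intro order.trans[OF degree_smult_le] degree_diff_le degree_sum_le) auto
  moreover have "fps_nth g k = poly P z"
    if "g * (A0 - fps_const z * A1) = C0 - fps_const z * C1" for z g
  proof -
    have "fps_nth (g * (A0 - fps_const z * A1)) k = fps_nth C0 k - z * fps_nth C1 k"
      using that by simp
    moreover have "fps_nth (g * (A0 - fps_const z * A1)) k =
        fps_nth g k * fps_nth A0 0 + (\<Sum>i<k. fps_nth g i * (fps_nth A0 (k - i) - z * fps_nth A1 (k - i)))"
      using assms(2) fps_mult_nth[of g "A0 - fps_const z * A1" k]
      by (simp add: atLeast0AtMost flip: lessThan_Suc_atMost)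
    moreover have "(\<Sum>i<k. fps_nth g i * (fps_nth A0 (k - i) - z * fps_nth A1 (k - i))) =
        (\<Sum>i<k. poly (Q i) z * (fps_nth A0 (k - i) - z * fps_nth A1 (k - i)))"
      using Q(2)[OF _ that] by (intro sum.cong) auto
    ultimately show ?thesis
      using assms(1) unfolding P_def by (simp add: poly_sum field_simps)
  qed
  ultimately show ?case by blast
qed

section \<open>The exterior map of a lens\<close>

locale lens =
  fixes \<beta> :: real
  assumes \<beta>: "0 < \<beta>" "\<beta> < pi / 2"
begin

text \<open>The lens is \<open>|z| < 1, Re z > cos \<beta>\<close>, with corners \<open>a\<close> and \<open>cnj a\<close>. A Moebius map turns
  its exterior into a sector of opening \<open>\<alpha> * pi\<close>, so the exterior map \<open>\<Psi>\<close> satisfies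
  \<open>(\<Psi> w - a) / (\<Psi> w - cnj a) = ((w - \<omega>) / (w - cnj \<omega>)) powr \<alpha> = p u / r u\<close> with \<open>u = 1 / w\<close>.
  The quotients \<open>p / r\<close> and \<open>\<Psi>\<close> are kept cleared of denominators, since they have poles at
  \<open>u = \<omega>\<close> and \<open>u = 0\<close>; \<open>D z u = 0\<close> means \<open>\<Psi> w = z\<close>, and \<open>h z u = w * \<Psi>' w / (\<Psi> w - z)\<close>.\<close>

definition "\<alpha> = 2 - \<beta> / pi"
definition "\<phi> = pi / \<alpha>"
definition "a = cis \<beta>"
definition "\<omega> = cis \<phi>"
definition "p u = (1 - \<omega> * u) powr of_real \<alpha>"
definition "r u = (1 - cnj \<omega> * u) powr of_real \<alpha>"
definition "p1 u = (1 - \<omega> * u) powr of_real (\<alpha> - 1)"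
definition "r1 u = (1 - cnj \<omega> * u) powr of_real (\<alpha> - 1)"
definition "D z u = (a - z) * r u - (cnj a - z) * p u"
definition "\<kappa> = (a - cnj a) * of_real \<alpha> * (\<omega> - cnj \<omega>)"
definition "h z u = u * \<kappa> * p1 u * r1 u / ((r u - p u) * D z u)"
definition "l u = Ln (1 - \<omega> * u) - Ln (1 - cnj \<omega> * u)"

lemma \<alpha>: "3/2 < \<alpha>" "\<alpha> < 2"
  using \<beta> by (auto simp: \<alpha>_def field_simps)

lemma \<alpha>_mult_pi: "\<alpha> * pi = 2 * pi - \<beta>"
  by (simp add: \<alpha>_def field_simps)

lemma \<alpha>_mult_\<phi>: "\<alpha> * \<phi> = pi"
  using \<alpha> by (simp add: \<phi>_def)

lemma \<phi>: "pi / 2 < \<phi>" "\<phi> < 2 * pi / 3"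
  using \<alpha> by (auto simp: \<phi>_def field_simps)

lemma sin_pos: "sin \<beta> > 0" "sin \<phi> > 0"
  using \<beta> \<phi> by (auto intro!: sin_gt_zero)

lemma norm_a [simp]: "norm a = 1" and norm_\<omega> [simp]: "norm \<omega> = 1"
  by (simp_all add: a_def \<omega>_def)

lemma a_cnj [simp]: "a * cnj a = 1" and \<omega>_cnj [simp]: "\<omega> * cnj \<omega> = 1"
  by (simp_all add: a_def \<omega>_def cis_cnj cis_mult)

lemma Re_one_minus:
  assumes "norm u \<le> 1" "norm w = 1" "1 - w * u \<noteq> 0"
  shows "Re (1 - w * u) > 0"
proof -
  have *: "norm (w * u) \<le> 1" using assms by (simp add: norm_mult)
  have "Re (w * u) \<noteq> 1"
  proof
    assume 1: "Re (w * u) = 1"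
    have "(Re (w * u))\<^sup>2 + (Im (w * u))\<^sup>2 \<le> 1"
      using * by (metis cmod_power2 power_le_one norm_ge_zero)
    then have "Im (w * u) = 0" using 1 by simp
    with 1 assms(3) show False by (simp add: complex_eq_iff)
  qed
  moreover have "Re (w * u) \<le> 1"
    using * complex_Re_le_cmod[of "w * u"] by linarith
  ultimately show ?thesis by simp
qed

lemma corner_disj: "1 - \<omega> * u \<noteq> 0 \<or> 1 - cnj \<omega> * u \<noteq> 0"
proof (rule ccontr)
  assume "\<not> ?thesis"
  then have *: "(\<omega> - cnj \<omega>) * u = 0" "u \<noteq> 0" by (auto simp: algebra_simps)
  then have "\<omega> = cnj \<omega>" by simp
  then show False
    using sin_pos by (auto simp: \<omega>_def complex_eq_iff)
qed

lemma p_eq: "1 - \<omega> * u \<noteq> 0 \<Longrightarrow> p u = exp (of_real \<alpha> * Ln (1 - \<omega> * u))"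
  and r_eq: "1 - cnj \<omega> * u \<noteq> 0 \<Longrightarrow> r u = exp (of_real \<alpha> * Ln (1 - cnj \<omega> * u))"
  by (simp_all add: p_def r_def powr_def mult.commute)

lemma p_eq_p1: "p u = (1 - \<omega> * u) * p1 u"
  and r_eq_r1: "r u = (1 - cnj \<omega> * u) * r1 u"
  by (simp_all add: p_def p1_def r_def r1_def powr_diff)

lemma p_nz: "p u \<noteq> 0 \<longleftrightarrow> 1 - \<omega> * u \<noteq> 0" and r_nz: "r u \<noteq> 0 \<longleftrightarrow> 1 - cnj \<omega> * u \<noteq> 0"
  by (simp_all add: p_def r_def)

lemma exp_l:
  assumes "1 - \<omega> * u \<noteq> 0" "1 - cnj \<omega> * u \<noteq> 0"
  shows "exp (l u) = (1 - \<omega> * u) / (1 - cnj \<omega> * u)"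
    and "exp (of_real \<alpha> * l u) = p u / r u"
  using assms by (simp_all add: l_def exp_diff p_eq r_eq right_diff_distrib)

text \<open>After clearing the denominator and rotating by \<open>cnj \<omega>\<close>, the
  imaginary part is \<open>sin \<phi> * (|u|^2 - 1)\<close>, so membership in the disc becomes the
  sign of \<open>sin (Im (l u) - \<phi>)\<close>. On the circle the real part
  \<open>2 * (cos \<phi> - Re u)\<close> separates the two boundary pieces.\<close>

lemma exp_l_mult:
  assumes "1 - \<omega> * u \<noteq> 0" "1 - cnj \<omega> * u \<noteq> 0"
  shows "exp (l u) * of_real ((norm (1 - cnj \<omega> * u))\<^sup>2) * cnj \<omega> =
    cnj \<omega> - of_real (2 * Re u) + \<omega> * of_real ((norm u)\<^sup>2)"
proof -
  have "exp (l u) * of_real ((norm (1 - cnj \<omega> * u))\<^sup>2) = (1 - \<omega> * u) * cnj (1 - cnj \<omega> * u)"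
    using assms by (simp add: exp_l complex_norm_square del: of_real_power)
  then have "exp (l u) * of_real ((norm (1 - cnj \<omega> * u))\<^sup>2) * cnj \<omega> =
     (1 - \<omega> * u) * (1 - \<omega> * cnj u) * cnj \<omega>" by simp
  also have "\<dots> = cnj \<omega> - (\<omega> * cnj \<omega>) * (u + cnj u) + (\<omega> * cnj \<omega>) * (\<omega> * (u * cnj u))"
    by (simp only: algebra_simps mult_1_left mult_1_right)
  also have "\<dots> = cnj \<omega> - of_real (2 * Re u) + \<omega> * of_real ((norm u)\<^sup>2)"
    by (simp add: complex_add_cnj complex_norm_square del: of_real_power)
  finally show ?thesis .
qed

lemma exp_l_polar:
  "exp (l u) * of_real c * cnj \<omega> = of_real (exp (Re (l u)) * c) * cis (Im (l u) - \<phi>)"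
  by (simp add: exp_eq_polar \<omega>_def cis_cnj mult.assoc mult.left_commute cis_mult)

text \<open>Both logarithms are of numbers with positive real part, so
  \<open>|Im (l u)| < pi\<close>. This fixes the branch, and the sign of
  \<open>sin (Im (l u) - \<phi>)\<close> then decides the interval.\<close>

lemma Im_l_range:
  assumes "norm u \<le> 1" "1 - \<omega> * u \<noteq> 0" "1 - cnj \<omega> * u \<noteq> 0"
  shows "\<phi> - pi \<le> Im (l u)" "Im (l u) \<le> \<phi>"
proof -
  have "Re (1 - \<omega> * u) > 0" "Re (1 - cnj \<omega> * u) > 0"
    using assms by (auto intro!: Re_one_minus simp del: minus_complex.sel)
  then have "\<bar>Im (Ln (1 - \<omega> * u))\<bar> < pi / 2" "\<bar>Im (Ln (1 - cnj \<omega> * u))\<bar> < pi / 2"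
    using Re_Ln_pos_lt assms(2,3) by blast+
  then have *: "- pi < Im (l u)" "Im (l u) < pi" by (auto simp: l_def)
  define c where "c = exp (Re (l u)) * (norm (1 - cnj \<omega> * u))\<^sup>2"
  have c: "c > 0" using assms by (simp add: c_def)
  have "c * sin (Im (l u) - \<phi>) = Im (of_real c * cis (Im (l u) - \<phi>))" by simp
  also have "of_real c * cis (Im (l u) - \<phi>) =
      cnj \<omega> - of_real (2 * Re u) + \<omega> * of_real ((norm u)\<^sup>2)"
    unfolding c_def exp_l_mult[OF assms(2,3), symmetric] exp_l_polar ..
  also have "Im \<dots> = sin \<phi> * ((norm u)\<^sup>2 - 1)"
    by (simp add: \<omega>_def algebra_simps)
  finally have "c * sin (Im (l u) - \<phi>) = sin \<phi> * ((norm u)\<^sup>2 - 1)" .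
  moreover have "sin \<phi> * ((norm u)\<^sup>2 - 1) \<le> 0"
    using sin_pos assms(1) by (intro mult_nonneg_nonpos) (auto simp: power_le_one)
  ultimately have s: "sin (Im (l u) - \<phi>) \<le> 0"
    using c by (smt (verit) mult_pos_pos)
  show "Im (l u) \<le> \<phi>"
  proof (rule ccontr)
    assume "\<not> ?thesis"
    then have "sin (Im (l u) - \<phi>) > 0" using * \<phi> by (intro sin_gt_zero) auto
    then show False using s by simp
  qed
  show "\<phi> - pi \<le> Im (l u)"
  proof (rule ccontr)
    assume "\<not> ?thesis"
    then have "sin (Im (l u) - \<phi> + 2 * pi) > 0" using * \<phi> by (intro sin_gt_zero) auto
    then show False using s by simp
  qed
qed

text \<open>The choice of \<phi> makes the upper end \<pi>, the argument of
  \<open>(z - a) / (z - cnj a)\<close> on the chord; the lower end \<open>\<beta> - pi\<close> is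
  its argument on the arc. The width \<open>2 * pi - \<beta>\<close> stays below a full
  turn.\<close>

lemma \<alpha>_Im_l_range:
  assumes "norm u \<le> 1" "1 - \<omega> * u \<noteq> 0" "1 - cnj \<omega> * u \<noteq> 0"
  shows "\<beta> - pi \<le> \<alpha> * Im (l u)" "\<alpha> * Im (l u) \<le> pi"
proof -
  have "\<alpha> * (\<phi> - pi) \<le> \<alpha> * Im (l u)" "\<alpha> * Im (l u) \<le> \<alpha> * \<phi>"
    using Im_l_range[OF assms] \<alpha>(1) by (intro mult_left_mono; simp)+
  then show "\<beta> - pi \<le> \<alpha> * Im (l u)" "\<alpha> * Im (l u) \<le> pi"
    using \<alpha>_mult_\<phi> \<alpha>_mult_pi right_diff_distrib[of \<alpha> \<phi> pi] by linarith+
qed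

text \<open>This is injectivity of the exterior map up to the boundary, corners excluded. The
  imaginary parts of \<open>\<alpha> * l\<close> differ by less than \<open>2 * pi\<close>, so equal
  exponentials have equal logarithms, and a Moebius map is injective.\<close>

lemma ratio_inj:
  assumes u: "norm u \<le> 1" "1 - \<omega> * u \<noteq> 0" "1 - cnj \<omega> * u \<noteq> 0"
    and v: "norm v \<le> 1" "1 - \<omega> * v \<noteq> 0" "1 - cnj \<omega> * v \<noteq> 0"
    and eq: "p u / r u = p v / r v"
  shows "u = v"
proof -
  have "exp (of_real \<alpha> * l u) = exp (of_real \<alpha> * l v)"
    by (simp only: exp_l(2)[OF u(2,3)] exp_l(2)[OF v(2,3)] eq)
  moreover have "\<bar>\<alpha> * Im (l u) - \<alpha> * Im (l v)\<bar> < 2 * pi"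
    using \<alpha>_Im_l_range[OF u] \<alpha>_Im_l_range[OF v] \<beta> by linarith
  then have "\<bar>Im (of_real \<alpha> * l u) - Im (of_real \<alpha> * l v)\<bar> < 2 * pi"
    by (simp only: Im_complex_of_real Re_complex_of_real times_complex.sel mult_zero_left add_0_right)
  ultimately have eq': "of_real \<alpha> * l u = of_real \<alpha> * l v"
    by (rule exp_complex_eqI[rotated])
  have "complex_of_real \<alpha> \<noteq> 0" using \<alpha>(1) by simp
  then have "l u = l v" by (rule mult_left_cancel[THEN iffD1, OF _ eq'])
  then have "exp (l u) = exp (l v)" by (rule arg_cong)
  then have "(1 - \<omega> * u) / (1 - cnj \<omega> * u) = (1 - \<omega> * v) / (1 - cnj \<omega> * v)"
    by (simp only: exp_l(1)[OF u(2,3)] exp_l(1)[OF v(2,3)])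
  then have "(1 - \<omega> * u) * (1 - cnj \<omega> * v) = (1 - \<omega> * v) * (1 - cnj \<omega> * u)"
    by (simp only: frac_eq_eq[OF u(3) v(3)])
  moreover have "(\<omega> - cnj \<omega>) * (u - v) =
      (1 - \<omega> * v) * (1 - cnj \<omega> * u) - (1 - \<omega> * u) * (1 - cnj \<omega> * v)"
    by algebra
  ultimately have "(\<omega> - cnj \<omega>) * (u - v) = 0" by (simp only: diff_self)
  moreover have "\<omega> \<noteq> cnj \<omega>"
    using sin_pos by (auto simp: \<omega>_def complex_eq_iff)
  ultimately show ?thesis by simp
qed

text \<open>A zero would make \<theta> the argument of \<open>(z - a) / (z - cnj a)\<close>, hence a
  number in \<open>[\<beta> - pi, pi]\<close>. For \<open>z\<close> in the lens, the half-plane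
  condition gives \<open>sin \<theta> < 0\<close> and the disc condition gives
  \<open>sin (\<theta> - \<beta>) > 0\<close>; no angle of that interval satisfies both.\<close>

lemma D_nz:
  assumes u: "norm u \<le> 1" and z: "norm z < 1" "Re z > cos \<beta>"
  shows "D z u \<noteq> 0"
proof
  assume D: "D z u = 0"
  have nz: "a - z \<noteq> 0" "cnj a - z \<noteq> 0" using z(1) norm_a by auto
  have u': "1 - \<omega> * u \<noteq> 0" "1 - cnj \<omega> * u \<noteq> 0"
    using D nz p_nz[of u] r_nz[of u] corner_disj[of u] by (auto simp: D_def)
  define \<theta> where "\<theta> = \<alpha> * Im (l u)"
  define c where "c = exp (\<alpha> * Re (l u)) * (norm (cnj a - z))\<^sup>2"
  have c: "c > 0" using nz by (simp add: c_def)
  have "a - z = (cnj a - z) * (p u / r u)"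
    using D r_nz[of u] u'(2) by (simp add: D_def eq_divide_eq)
  then have "a - z = (cnj a - z) * exp (of_real \<alpha> * l u)"
    by (simp only: exp_l[OF u'])
  \<comment> \<open>The factor \<open>a - cnj z\<close> is the conjugate of
    \<open>cnj a - z\<close>, so the quotient becomes a product that is a positive multiple of
    \<open>cis \<theta>\<close>.\<close>
  then have "(a - z) * (a - cnj z) = ((cnj a - z) * exp (of_real \<alpha> * l u)) * (a - cnj z)"
    by (rule arg_cong)
  also have "\<dots> = (cnj a - z) * cnj (cnj a - z) * exp (of_real \<alpha> * l u)"
    by simp
  also have "\<dots> = of_real c * cis \<theta>"
    by (simp add: c_def \<theta>_def exp_eq_polar complex_norm_square del: of_real_power)
  finally have eq: "(a - z) * (a - cnj z) = of_real c * cis \<theta>" .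
  have e: "(a - z) * (a - cnj z) = a * a - of_real (2 * Re z) * a + of_real ((norm z)\<^sup>2)"
  proof -
    have "(a - z) * (a - cnj z) = a * a - (z + cnj z) * a + z * cnj z"
      by (simp only: algebra_simps)
    then show ?thesis by (simp only: complex_add_cnj complex_norm_square)
  qed
  have "c * sin \<theta> = Im (of_real c * cis \<theta>)" by simp
  also have "\<dots> = Im (a * a - of_real (2 * Re z) * a + of_real ((norm z)\<^sup>2))"
    by (simp only: eq[symmetric] e)
  also have "\<dots> = 2 * sin \<beta> * (cos \<beta> - Re z)"
    by (simp add: a_def algebra_simps)
  also have "\<dots> < 0" using sin_pos z by (intro mult_pos_neg) auto
  finally have 1: "sin \<theta> < 0" using c by (simp add: mult_less_0_iff)
  have "of_real c * cis (\<theta> - \<beta>) = cnj a * (of_real c * cis \<theta>)"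
    by (simp add: a_def cis_cnj cis_mult)
  also have "\<dots> = a * (a * cnj a) - of_real (2 * Re z) * (a * cnj a) + cnj a * of_real ((norm z)\<^sup>2)"
    unfolding eq[symmetric] e by (simp only: algebra_simps)
  finally have *: "of_real c * cis (\<theta> - \<beta>) = a - of_real (2 * Re z) + cnj a * of_real ((norm z)\<^sup>2)"
    by (simp only: a_cnj mult_1_right)
  have "c * sin (\<theta> - \<beta>) = Im (of_real c * cis (\<theta> - \<beta>))" by simp
  also have "\<dots> = Im (a - of_real (2 * Re z) + cnj a * of_real ((norm z)\<^sup>2))"
    by (simp only: *)
  also have "\<dots> = sin \<beta> * (1 - (norm z)\<^sup>2)"
    by (simp add: a_def algebra_simps)
  also have "\<dots> > 0" using sin_pos z by (intro mult_pos_pos) (auto simp: abs_square_less_1)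
  finally have 2: "sin (\<theta> - \<beta>) > 0" using c by (simp add: zero_less_mult_iff)
  have \<theta>: "\<beta> - pi \<le> \<theta>" "\<theta> \<le> pi"
    using \<alpha>_Im_l_range[OF u u'] by (auto simp: \<theta>_def)
  have "\<theta> < 0" using 1 \<theta> sin_ge_zero[of \<theta>] by linarith
  then have "sin (\<theta> - \<beta> + pi) \<ge> 0" using \<theta> \<beta> by (intro sin_ge_zero) auto
  then show False using 2 by simp
qed

end

section \<open>Boundary values of \<open>h\<close> on the arc and on the chord\<close>

context lens begin

definition "K = 4 * \<alpha> * sin \<beta> * sin \<phi>"

lemma K_pos: "K > 0"
  using \<alpha> sin_pos by (simp add: K_def)

text \<open>Differentiating \<Psi> leaves the Wronskian of \<open>p\<close> and \<open>r\<close>, a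
  constant multiple of \<open>p1 * r1\<close>; this constant and the factor \<open>a - cnj a\<close>
  make up \<kappa>. Both \<open>a - cnj a\<close> and \<open>\<omega> - cnj \<omega>\<close> are
  purely imaginary, which accounts for the sign.\<close>

lemma \<kappa>_eq: "\<kappa> = - of_real K"
  by (simp add: \<kappa>_def K_def a_def \<omega>_def complex_eq_iff)

text \<open>On the unit circle \<open>sin (Im (l u) - \<phi>) = 0\<close>, so
  \<open>Im (l u)\<close> sits at an end of its range: \<open>\<phi> - pi\<close> on the arc, \<phi>
  on the chord. The sign of \<open>cos \<phi> - Re u\<close> tells which.\<close>

lemma boundary_ratio:
  assumes u: "norm u = 1" "1 - \<omega> * u \<noteq> 0" "1 - cnj \<omega> * u \<noteq> 0"
  obtains X where "X > 0" "Re u > cos \<phi>" "p u = - of_real X * a * r u"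
  | X where "X > 0" "Re u < cos \<phi>" "p u = - of_real X * r u"
proof -
  define \<theta> where "\<theta> = Im (l u)"
  define c where "c = exp (Re (l u)) * (norm (1 - cnj \<omega> * u))\<^sup>2"
  define X where "X = exp (\<alpha> * Re (l u))"
  have c: "c > 0" using u by (simp add: c_def)
  have X: "X > 0" by (simp add: X_def)
  have "p u = exp (of_real \<alpha> * l u) * r u"
    using u r_nz[of u] by (simp add: exp_l(2))
  also have "exp (of_real \<alpha> * l u) = of_real X * cis (\<alpha> * \<theta>)"
    by (simp add: X_def \<theta>_def exp_eq_polar)
  finally have p: "p u = of_real X * cis (\<alpha> * \<theta>) * r u" .
  have *: "of_real c * cis (\<theta> - \<phi>) = cnj \<omega> - of_real (2 * Re u) + \<omega>"
    using exp_l_mult[OF u(2,3)] unfolding c_def \<theta>_def exp_l_polar u(1) by simp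
  have "c * sin (\<theta> - \<phi>) = Im (of_real c * cis (\<theta> - \<phi>))" by simp
  also have "\<dots> = 0" unfolding * by (simp add: \<omega>_def)
  finally have s: "sin (\<theta> - \<phi>) = 0" using c by simp
  have "c * cos (\<theta> - \<phi>) = Re (of_real c * cis (\<theta> - \<phi>))" by simp
  also have "\<dots> = 2 * (cos \<phi> - Re u)" unfolding * by (simp add: \<omega>_def)
  finally have co: "c * cos (\<theta> - \<phi>) = 2 * (cos \<phi> - Re u)" .
  have \<theta>: "\<phi> - pi \<le> \<theta>" "\<theta> \<le> \<phi>"
    using Im_l_range[of u] u by (auto simp: \<theta>_def)
  have "\<theta> = \<phi> \<or> \<theta> = \<phi> - pi"
  proof (rule ccontr)
    assume "\<not> ?thesis"
    then have "sin (\<phi> - \<theta>) > 0" using \<theta> by (intro sin_gt_zero) auto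
    moreover have "sin (\<phi> - \<theta>) = - sin (\<theta> - \<phi>)" by (metis minus_diff_eq sin_minus)
    ultimately show False using s by simp
  qed
  then show ?thesis
  proof
    assume "\<theta> = \<phi>"
    then show ?thesis using that(2)[OF X] co c p \<alpha>_mult_\<phi> by simp
  next
    assume \<theta>: "\<theta> = \<phi> - pi"
    then have "\<alpha> * \<theta> = \<alpha> * \<phi> - \<alpha> * pi" by (simp only: right_diff_distrib)
    then have "\<alpha> * \<theta> = \<beta> - pi"
      using \<alpha>_mult_\<phi> \<alpha>_mult_pi by linarith
    moreover have "cis (\<beta> - pi) = - a" by (simp add: a_def complex_eq_iff)
    ultimately show ?thesis using that(1)[OF X] co c p \<theta> by simp
  qed
qed

text \<open>On the circle \<open>(1 - \<omega> * u) * (1 - cnj \<omega> * u)\<close> is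
  \<open>u\<close> times a real number, so \<open>u * p1 u * r1 u\<close> is a real multiple of
  \<open>p u * r u\<close>. What remains depends on \<open>u\<close> only through a real factor,
  \<open>p u\<close> and \<open>r u\<close>.\<close>

lemma h_boundary:
  assumes u: "norm u = 1" "1 - \<omega> * u \<noteq> 0" "1 - cnj \<omega> * u \<noteq> 0"
  shows "h z u = - of_real (K / (2 * (Re u - cos \<phi>))) * (p u * r u / ((r u - p u) * D z u))"
proof -
  have "(1 - \<omega> * u) * (1 - cnj \<omega> * u) = 1 - (\<omega> + cnj \<omega>) * u + (\<omega> * cnj \<omega>) * u * u"
    by (simp add: algebra_simps)
  also have "\<dots> = u * cnj u - of_real (2 * cos \<phi>) * u + u * u"
    using u(1) by (simp add: complex_norm_square[symmetric] complex_add_cnj \<omega>_def)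
  also have "\<dots> = u * ((u + cnj u) - of_real (2 * cos \<phi>))"
    by (simp add: algebra_simps)
  also have "\<dots> = u * of_real (2 * (Re u - cos \<phi>))"
    by (simp add: complex_add_cnj right_diff_distrib)
  finally have q: "(1 - \<omega> * u) * (1 - cnj \<omega> * u) = u * of_real (2 * (Re u - cos \<phi>))" .
  then have ne: "complex_of_real (2 * (Re u - cos \<phi>)) \<noteq> 0" using u(2,3) by auto
  have "p u * r u = ((1 - \<omega> * u) * (1 - cnj \<omega> * u)) * (p1 u * r1 u)"
    unfolding p_eq_p1 r_eq_r1 by (simp only: mult_ac)
  then have "u * p1 u * r1 u = p u * r u / of_real (2 * (Re u - cos \<phi>))"
    unfolding q using ne by (simp add: field_simps)
  moreover have "u * \<kappa> * p1 u * r1 u = \<kappa> * (u * p1 u * r1 u)" by (simp only: mult_ac)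
  ultimately have "u * \<kappa> * p1 u * r1 u = - of_real (K / (2 * (Re u - cos \<phi>))) * (p u * r u)"
    using \<kappa>_eq by simp
  then show ?thesis unfolding h_def by simp
qed

text \<open>The boundary point is \<open>Z / A = 1 / Y\<close>. The vector
  \<open>w * \<Psi>' w\<close> is the outer normal there, which on the unit circle is a positive
  multiple of the point itself, so \<open>h z\<close> is a positive multiple of
  \<open>\<Psi> / (\<Psi> - z)\<close>.\<close>

lemma h_arc:
  assumes u: "norm u = 1" "1 - \<omega> * u \<noteq> 0" "1 - cnj \<omega> * u \<noteq> 0"
    and X: "X > 0" "Re u > cos \<phi>" "p u = - of_real X * a * r u"
  obtains C Y where "C > 0" "norm Y = 1" "\<And>z. h z u = of_real C / (1 - z * Y)"
proof -
  define A where "A = 1 + a * of_real X"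
  define Z where "Z = a + of_real X"
  have Z: "Z = a * cnj A" by (simp add: A_def Z_def algebra_simps)
  have "Im A > 0" using X sin_pos by (simp add: A_def a_def)
  then have A0: "A \<noteq> 0" by auto
  have a0: "a \<noteq> 0" using norm_a by force
  define C where "C = K / (2 * (Re u - cos \<phi>)) * X / (norm A)\<^sup>2"
  have "C > 0" using K_pos X A0 by (simp add: C_def)
  moreover have "norm (A / Z) = 1" using A0 by (simp add: Z norm_divide norm_mult)
  moreover have "h z u = of_real C / (1 - z * (A / Z))" for z
  proof -
    have r0: "r u \<noteq> 0" using u r_nz by blast
    have "r u - p u = r u * A" "D z u = r u * (Z - z * A)"
      unfolding D_def X(3) A_def Z_def by (simp_all add: algebra_simps)
    then have "p u * r u / ((r u - p u) * D z u) = - of_real X * (a / (A * (Z - z * A)))"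
      using r0 unfolding X(3) by simp
    also have "a / (A * (Z - z * A)) = 1 / (of_real ((norm A)\<^sup>2) * (1 - z * (A / Z)))"
    proof -
      have "A * (Z - z * A) = A * Z * (1 - z * (A / Z))"
        using A0 a0 by (simp add: Z field_simps)
      also have "A * Z = a * of_real ((norm A)\<^sup>2)"
        by (simp add: Z complex_norm_square del: of_real_power)
      finally show ?thesis using a0 by simp
    qed
    finally show ?thesis
      unfolding h_boundary[OF u] C_def by simp
  qed
  ultimately show ?thesis by (rule that)
qed

text \<open>Here \<open>y = Z / A\<close> is the boundary point, and the outer normal of the lens
  points in the negative real direction; hence a numerator \<open>C < 0\<close>.\<close>

lemma h_chord:
  assumes u: "norm u = 1" "1 - \<omega> * u \<noteq> 0" "1 - cnj \<omega> * u \<noteq> 0"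
    and X: "X > 0" "Re u < cos \<phi>" "p u = - of_real X * r u"
  obtains C y where "C < 0" "Re y = cos \<beta>" "\<And>z. h z u = of_real C / (y - z)"
proof -
  define A where "A = 1 + complex_of_real X"
  define Z where "Z = a + cnj a * of_real X"
  have A: "A = of_real (1 + X)" by (simp add: A_def)
  have A0: "A \<noteq> 0" unfolding A of_real_eq_0_iff using X by linarith
  define C where "C = K / (2 * (Re u - cos \<phi>)) * X / (1 + X)\<^sup>2"
  have "C < 0" using K_pos X by (simp add: C_def divide_simps mult_less_0_iff zero_less_mult_iff)
  moreover have "Re (Z / A) = cos \<beta>"
    using X(1) unfolding A Re_divide_of_real by (simp add: Z_def a_def field_simps)
  moreover have "h z u = of_real C / (Z / A - z)" for z
  proof -
    have r0: "r u \<noteq> 0" using u r_nz by blast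
    have "r u - p u = r u * A" "D z u = r u * (Z - z * A)"
      unfolding D_def X(3) A_def Z_def by (simp_all add: algebra_simps)
    then have "p u * r u / ((r u - p u) * D z u) = - of_real X * (1 / (A * (Z - z * A)))"
      using r0 unfolding X(3) by simp
    also have "A * (Z - z * A) = A\<^sup>2 * (Z / A - z)"
      using A0 by (simp add: field_simps power2_eq_square)
    also have "A\<^sup>2 = of_real ((1 + X)\<^sup>2)" by (simp add: A)
    finally show ?thesis
      unfolding h_boundary[OF u] C_def by simp
  qed
  ultimately show ?thesis by (rule that)
qed

lemma Re_inverse_one_minus_ge:
  assumes "norm w < 1"
  shows "Re (1 / (1 - w)) \<ge> 1 / 2"
proof -
  have "w \<noteq> 1" using assms by auto
  then have pos: "(norm (1 - w))\<^sup>2 > 0" by simp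
  have "(norm w)\<^sup>2 < 1" using assms by (simp add: abs_square_less_1)
  then have "(Re w)\<^sup>2 + (Im w)\<^sup>2 < 1" by (simp add: cmod_power2)
  then have "(norm (1 - w))\<^sup>2 \<le> 2 * (1 - Re w)"
    unfolding cmod_power2 by (simp add: power2_eq_square algebra_simps)
  moreover have "Re (1 / (1 - w)) = (1 - Re w) / (norm (1 - w))\<^sup>2"
    by (simp add: Re_divide cmod_power2)
  moreover have "1 / 2 * n \<le> m" if "n \<le> 2 * m" for n m :: real
    using that by simp
  ultimately show ?thesis
    using pos by (simp only: le_divide_eq if_True)
qed

text \<open>On the arc \<open>h 0 u\<close> is the constant \<open>C\<close> and
  \<open>Re (h z u) \<ge> C / 2\<close>, because \<open>1 / (1 - v)\<close> has real part at least
  1/2 for \<open>|v| < 1\<close>; this is the source of the factor 2. On the chord both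
  \<open>C\<close> and \<open>Re (y - z)\<close> are negative while \<open>Re y > 0\<close>, so 0
  separates the two real parts.\<close>

lemma boundary_ineq:
  assumes u: "norm u = 1" and z: "norm z < 1" "Re z > cos \<beta>"
  shows "0 \<le> Re (h z u)" "Re (h 0 u) \<le> 2 * Re (h z u)"
proof -
  have "0 \<le> Re (h z u) \<and> Re (h 0 u) \<le> 2 * Re (h z u)"
  proof (cases "1 - \<omega> * u \<noteq> 0 \<and> 1 - cnj \<omega> * u \<noteq> 0")
    case False
    \<comment> \<open>At a corner one factor of the numerator vanishes, so \<open>h\<close> is 0
      there for every point and both inequalities are trivial.\<close>
    then have "p1 u = 0 \<or> r1 u = 0" by (auto simp: p1_def r1_def)
    then have "h w u = 0" for w by (auto simp: h_def)
    then show ?thesis by simp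
  next
    case True
    then consider (arc) X where "X > 0" "Re u > cos \<phi>" "p u = - of_real X * a * r u"
      | (chord) X where "X > 0" "Re u < cos \<phi>" "p u = - of_real X * r u"
      using boundary_ratio[of u] u by blast
    then show ?thesis
    proof cases
      case (arc X)
      then obtain C Y where C: "C > 0" "norm Y = 1" "\<And>z. h z u = of_real C / (1 - z * Y)"
        using h_arc[of u X] u True by blast
      have "Re (h z u) = C * Re (1 / (1 - z * Y))"
        unfolding C(3) by (simp add: Re_divide)
      moreover have "Re (1 / (1 - z * Y)) \<ge> 1/2"
        using z C by (intro Re_inverse_one_minus_ge) (simp add: norm_mult)
      ultimately have "Re (h z u) \<ge> C * (1/2)" using C(1) by simp
      moreover have "Re (h 0 u) = C" by (simp add: C(3))
      ultimately show ?thesis using C(1) by simp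
    next
      case (chord X)
      then obtain C y where C: "C < 0" "Re y = cos \<beta>" "\<And>z. h z u = of_real C / (y - z)"
        using h_chord[of u X] u True by blast
      have *: "Re (h w u) = C * Re (y - w) / (norm (y - w))\<^sup>2" for w
        unfolding C(3) by (simp add: Re_divide cmod_power2)
      have "cos \<beta> > 0" using \<beta> by (intro cos_gt_zero) auto
      then have "Re (h 0 u) \<le> 0"
        unfolding * using C by (simp add: divide_nonpos_nonneg mult_nonpos_nonneg)
      moreover have "Re (h z u) \<ge> 0"
        unfolding * using C z by (simp add: divide_nonneg_nonneg mult_nonpos_nonpos)
      ultimately show ?thesis by simp
    qed
  qed
  then show "0 \<le> Re (h z u)" "Re (h 0 u) \<le> 2 * Re (h z u)" by auto
qed

end

section \<open>Division by simple zeros inside the closed disc\<close>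

definition slope :: "(complex \<Rightarrow> complex) \<Rightarrow> complex \<Rightarrow> complex \<Rightarrow> complex" where
  "slope f c u = (if u = c then deriv f c else (f u - f c) / (u - c))"

text \<open>Holomorphy at \<open>c\<close> is removal of the singularity. Continuity up to the
  circle is glued from two relatively open pieces, the open disc and the closed disc without
  \<open>c\<close>; they cover because \<open>c\<close> is interior.\<close>

lemma slope_disc:
  assumes f: "continuous_on (cball 0 1) f" "f holomorphic_on ball 0 1" and c: "norm c < 1"
  shows "slope f c holomorphic_on ball 0 1" "continuous_on (cball 0 1) (slope f c)"
proof -
  show hol: "slope f c holomorphic_on ball 0 1"
    using pole_lemma_open[OF f(2), of c] by (simp add: slope_def[abs_def])
  have "continuous_on (cball 0 1 - {c}) (\<lambda>u. (f u - f c) / (u - c))"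
    by (intro continuous_intros continuous_on_subset[OF f(1)]) auto
  then have 1: "continuous_on (cball 0 1 - {c}) (slope f c)"
    by (rule continuous_on_eq) (auto simp: slope_def)
  have 2: "continuous_on (ball 0 1) (slope f c)"
    using hol by (rule holomorphic_on_imp_continuous_on)
  have eq: "cball 0 1 = ball 0 1 \<union> (cball 0 1 - {c})"
    using c by auto
  have "openin (top_of_set (cball 0 1)) (cball 0 1 \<inter> ball (0::complex) 1)"
    and "openin (top_of_set (cball 0 1)) (cball (0::complex) 1 \<inter> - {c})"
    by (simp_all add: openin_open_Int open_Compl)
  moreover have "cball 0 1 \<inter> ball (0::complex) 1 = ball 0 1" "cball 0 1 \<inter> - {c} = cball 0 1 - {c}"
    by auto
  ultimately have "openin (top_of_set (ball 0 1 \<union> (cball 0 1 - {c}))) (ball (0::complex) 1)"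
    and "openin (top_of_set (ball 0 1 \<union> (cball 0 1 - {c}))) (cball (0::complex) 1 - {c})"
    by (simp_all only: eq[symmetric])
  then have "continuous_on (ball 0 1 \<union> (cball 0 1 - {c})) (slope f c)"
    using 2 1 by (rule continuous_on_Un_local_open)
  then show "continuous_on (cball 0 1) (slope f c)" by (simp only: eq[symmetric])
qed

lemma eq_minus_times_inverse:
  fixes x y z b :: complex
  assumes "x * - (y * y) = b" "y * z = 1"
  shows "x = - b * z * z"
proof -
  have "- b * z * z = x * (y * z) * (y * z)"
    unfolding assms(1)[symmetric] by (simp add: algebra_simps)
  then show ?thesis using assms(2) by simp
qed

context lens begin

text \<open>\<open>u0\<close> is the point with \<open>\<Psi> (1 / u0) = 0\<close>. \<open>H z\<close> extends \<open>h z\<close> to \<open>u = 0\<close>, and \<open>G z\<close> extends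
  \<open>h z u - h 0 u + u0 / (u0 - u)\<close> to \<open>u = u0\<close>, where the pole of \<open>h 0\<close> cancels.\<close>

definition "u0 = 2 * cos \<phi>"
definition "\<gamma> = - 2 * cos \<phi>"
definition "E = slope (\<lambda>u. r u - p u) 0"
definition "F = slope (D 0) (of_real u0)"
definition "H z u = \<kappa> * p1 u * r1 u / (E u * D z u)"
definition "M z u = \<kappa> * z * u * p1 u * r1 u / (F u * D z u)"
definition "G z = slope (M z) (of_real u0)"

lemma u0: "-1 < u0" "u0 < 0"
proof -
  have "cos \<phi> < cos (pi/2)" using \<phi> by (intro cos_monotone_0_pi) auto
  then show "u0 < 0" by (simp add: u0_def)
  have "cos (2 * pi / 3) < cos \<phi>" using \<phi> by (intro cos_monotone_0_pi) auto
  moreover have "cos (2 * pi / 3) = - 1 / 2" using cos_120 by simp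
  ultimately show "-1 < u0" by (simp add: u0_def)
qed

text \<open>The angle is \<open>\<phi> - pi / 2\<close>: the denominator is
  \<open>2 * \<alpha>\<close>, and \<open>\<alpha> * pi = 2 * pi - \<beta>\<close>,
  \<open>\<alpha> * \<phi> = pi\<close>.\<close>

lemma \<gamma>_eq: "\<gamma> = 2 * sin (\<beta> / (4 - 2 * \<beta> / pi))"
proof -
  have "4 - 2 * \<beta> / pi = 2 * \<alpha>" by (simp add: \<alpha>_def)
  then have "\<beta> / (4 - 2 * \<beta> / pi) = \<beta> / (2 * \<alpha>)" by simp
  also have "\<dots> = \<phi> - pi / 2"
    using \<alpha> \<alpha>_mult_pi by (simp add: \<phi>_def field_simps)
  finally show ?thesis by (simp add: \<gamma>_def sin_diff)
qed

lemma \<gamma>: "0 < \<gamma>" "\<gamma> < 1" "u0 = - \<gamma>"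
  using u0 by (auto simp: u0_def \<gamma>_def)

text \<open>In the closed disc \<open>1 - w * u\<close> stays in the closed right half-plane, away
  from the branch cut except at 0, where the positive exponent gives continuity.\<close>

lemma power_cont:
  assumes "norm w = 1" "e > 0"
  shows "continuous_on (cball 0 1) (\<lambda>u. (1 - w * u) powr complex_of_real e)"
proof (intro continuous_on_powr_complex continuous_intros subsetI)
  fix u :: complex assume "u \<in> cball 0 1"
  then have "0 \<le> Re (1 - w * u)"
    using Re_one_minus[OF _ assms(1), of u]
    by (cases "1 - w * u = 0") (simp only: zero_complex.sel, simp del: minus_complex.sel right_minus_eq)
  then show "u \<in> {z. 0 \<le> Re (1 - w * z) \<or> Im (1 - w * z) \<noteq> 0}" by blast
qed (use assms in auto)

lemma one_minus_nonneg:
  fixes w u :: complex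
  assumes "norm w = 1" "norm u < 1"
  shows "1 - w * u \<notin> \<real>\<^sub>\<le>\<^sub>0"
proof -
  have "1 - w * u \<noteq> 0"
  proof
    assume "1 - w * u = 0"
    then have "w * u = 1" by simp
    then have "norm w * norm u = 1" by (simp only: norm_mult[symmetric] norm_one)
    then show False using assms by simp
  qed
  then have "Re (1 - w * u) > 0" using Re_one_minus[of u w] assms by simp
  then show ?thesis by (auto simp: complex_nonpos_Reals_iff)
qed

lemma power_holo:
  assumes "norm w = 1"
  shows "(\<lambda>u. (1 - w * u) powr complex_of_real e) holomorphic_on ball 0 1"
  using assms by (intro holomorphic_intros) (auto simp: one_minus_nonneg)

lemma power_deriv:
  assumes "norm w = 1" "norm u < 1"
  shows "((\<lambda>u. (1 - w * u) powr complex_of_real e) has_field_derivative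
      - (of_real e * w * (1 - w * u) powr of_real (e - 1))) (at u)"
proof -
  have "((\<lambda>u. 1 - w * u) has_field_derivative - w) (at u)"
    by (auto intro!: derivative_eq_intros)
  from DERIV_chain2[OF has_field_derivative_powr[OF one_minus_nonneg[OF assms], of "of_real e"] this]
  show ?thesis by (simp add: mult_ac)
qed

lemma cont: "continuous_on (cball 0 1) p" "continuous_on (cball 0 1) r"
    "continuous_on (cball 0 1) p1" "continuous_on (cball 0 1) r1"
  using \<alpha> unfolding p_def r_def p1_def r1_def by (intro power_cont; simp)+

lemma cont_D: "continuous_on (cball 0 1) (D z)"
  unfolding D_def by (intro continuous_intros cont)

lemma holo: "p holomorphic_on ball 0 1" "r holomorphic_on ball 0 1"
    "p1 holomorphic_on ball 0 1" "r1 holomorphic_on ball 0 1" "D z holomorphic_on ball 0 1"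
  unfolding D_def p_def r_def p1_def r1_def
  by (intro holomorphic_intros power_holo; simp)+

lemma deriv_pr:
  assumes "norm u < 1"
  shows "(p has_field_derivative - (of_real \<alpha> * \<omega> * p1 u)) (at u)"
    "(r has_field_derivative - (of_real \<alpha> * cnj \<omega> * r1 u)) (at u)"
  using power_deriv[of _ u \<alpha>, OF _ assms] unfolding p_def r_def p1_def r1_def by auto

lemma at_zero [simp]: "p 0 = 1" "r 0 = 1" "p1 0 = 1" "r1 0 = 1" "D z 0 = a - cnj a"
  by (auto simp: p_def r_def p1_def r1_def D_def)

lemma \<omega>_ne: "\<omega> - cnj \<omega> \<noteq> 0" and a_ne: "a - cnj a \<noteq> 0" and a_nz: "a \<noteq> 0"
  using sin_pos by (auto simp: \<omega>_def a_def complex_eq_iff)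

lemma \<alpha>_nz: "complex_of_real \<alpha> \<noteq> 0"
  using \<alpha> by simp

text \<open>Since \<open>u0 = \<omega> + cnj \<omega>\<close>, the two bases are
  \<open>- \<omega>^2\<close> and its conjugate, of modulus one and argument
  \<open>\<plusminus>(2 * \<phi> - pi)\<close>. This lies in the principal range, and \<alpha> times
  it is \<open>\<plusminus>\<beta>\<close>.\<close>

lemma at_u0: "1 - \<omega> * of_real u0 = - (\<omega> * \<omega>)" "1 - cnj \<omega> * of_real u0 = - (cnj \<omega> * cnj \<omega>)"
    "p (of_real u0) = a" "r (of_real u0) = cnj a"
    "p1 (of_real u0) = - a * cnj \<omega> * cnj \<omega>" "r1 (of_real u0) = - cnj a * \<omega> * \<omega>"
    "D 0 (of_real u0) = 0"
proof -
  have u: "complex_of_real u0 = \<omega> + cnj \<omega>" by (simp add: u0_def complex_add_cnj \<omega>_def)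
  have "1 - \<omega> * of_real u0 = 1 - \<omega> * cnj \<omega> - \<omega> * \<omega>" unfolding u by (simp only: algebra_simps)
  then show 1: "1 - \<omega> * of_real u0 = - (\<omega> * \<omega>)" by simp
  have "1 - cnj \<omega> * of_real u0 = 1 - \<omega> * cnj \<omega> - cnj \<omega> * cnj \<omega>"
    unfolding u by (simp only: algebra_simps)
  then show 2: "1 - cnj \<omega> * of_real u0 = - (cnj \<omega> * cnj \<omega>)" by simp
  have cis: "cis t powr of_real \<alpha> = cis (\<alpha> * t)" if "- pi < t" "t \<le> pi" for t
  proof -
    have "Ln (cis t) = \<i> * of_real t"
      using that by (simp add: cis_conv_exp Ln_exp)
    then show ?thesis by (simp add: powr_def cis_conv_exp mult_ac)
  qed
  have c1: "- (\<omega> * \<omega>) = cis (2 * \<phi> - pi)" and c2: "- (cnj \<omega> * cnj \<omega>) = cis (pi - 2 * \<phi>)"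
    by (simp_all add: \<omega>_def cis_mult cis_cnj complex_eq_iff)
  have e: "\<alpha> * (2 * \<phi> - pi) = \<beta>" "\<alpha> * (pi - 2 * \<phi>) = - \<beta>"
    using \<alpha>_mult_\<phi> \<alpha>_mult_pi by (simp_all add: right_diff_distrib)
  show pu: "p (of_real u0) = a"
    using \<phi> unfolding p_def 1 c1 by (simp add: cis e a_def)
  show ru: "r (of_real u0) = cnj a"
    using \<phi> unfolding r_def 2 c2 by (simp add: cis e a_def cis_cnj)
  have "p1 (of_real u0) * - (\<omega> * \<omega>) = a"
    using pu p_eq_p1[of "of_real u0"] unfolding 1 by (simp add: mult_ac)
  then show "p1 (of_real u0) = - a * cnj \<omega> * cnj \<omega>"
    by (rule eq_minus_times_inverse) simp
  have "r1 (of_real u0) * - (cnj \<omega> * cnj \<omega>) = cnj a"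
    using ru r_eq_r1[of "of_real u0"] unfolding 2 by (simp add: mult_ac)
  then show "r1 (of_real u0) = - cnj a * \<omega> * \<omega>"
    by (rule eq_minus_times_inverse) (simp add: mult.commute)
  show "D 0 (of_real u0) = 0" unfolding D_def pu ru by (simp add: mult.commute)
qed

text \<open>The cleared form allows corners as well: \<open>p\<close> and \<open>r\<close> never
  vanish together, so a solution is not a corner. The pair \<open>(1, 1)\<close> describes the pole
  of \<Psi>, only at \<open>u = 0\<close>; the pair \<open>(a, cnj a)\<close> describes its zero,
  only at \<open>u0\<close>.\<close>

lemma ratio_unique:
  assumes u: "norm u \<le> 1" and v: "norm v < 1"
    and eq: "x * r u = y * p u" "x * r v = y * p v" "x \<noteq> 0" "y \<noteq> 0"
  shows "u = v"
proof -
  have nz: "1 - \<omega> * w \<noteq> 0 \<and> 1 - cnj \<omega> * w \<noteq> 0" if "x * r w = y * p w" for w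
    using that eq corner_disj[of w] p_nz[of w] r_nz[of w] by auto
  have ratio: "p w / r w = x / y" if "x * r w = y * p w" for w
    using that nz[OF that] r_nz[of w] eq by (simp add: frac_eq_eq mult_ac)
  show ?thesis
    using ratio_inj[of u v] nz ratio eq u v by simp
qed

lemma rp_nz: "norm u \<le> 1 \<Longrightarrow> u \<noteq> 0 \<Longrightarrow> r u - p u \<noteq> 0"
  using ratio_unique[of u 0 1 1] by auto

lemma D0_nz: "norm u \<le> 1 \<Longrightarrow> u \<noteq> of_real u0 \<Longrightarrow> D 0 u \<noteq> 0"
  using ratio_unique[of u "of_real u0" a "cnj a"] u0 at_u0 a_nz by (auto simp: D_def)

lemma E: "E 0 = of_real \<alpha> * (\<omega> - cnj \<omega>)" "norm u \<le> 1 \<Longrightarrow> E u \<noteq> 0"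
proof -
  have "((\<lambda>u. r u - p u) has_field_derivative
      - (of_real \<alpha> * cnj \<omega> * r1 0) - - (of_real \<alpha> * \<omega> * p1 0)) (at 0)"
    by (intro DERIV_diff deriv_pr) auto
  then show E0: "E 0 = of_real \<alpha> * (\<omega> - cnj \<omega>)"
    by (simp add: E_def slope_def DERIV_imp_deriv algebra_simps)
  show "E u \<noteq> 0" if "norm u \<le> 1"
    using rp_nz[of u] that E0 \<omega>_ne \<alpha>_nz by (cases "u = 0") (auto simp: E_def slope_def)
qed

lemma F: "F (of_real u0) = of_real \<alpha> * (\<omega> - cnj \<omega>)" "norm u \<le> 1 \<Longrightarrow> F u \<noteq> 0"
proof -
  have n: "norm (complex_of_real u0) < 1" using u0 by simp
  have "(D 0 has_field_derivative
      a * - (of_real \<alpha> * cnj \<omega> * r1 (of_real u0)) - cnj a * - (of_real \<alpha> * \<omega> * p1 (of_real u0)))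
      (at (of_real u0))"
    unfolding D_def diff_zero by (intro DERIV_diff DERIV_cmult deriv_pr n)
  also have "a * - (of_real \<alpha> * cnj \<omega> * r1 (of_real u0)) - cnj a * - (of_real \<alpha> * \<omega> * p1 (of_real u0))
      = of_real \<alpha> * (a * cnj a) * (\<omega> * cnj \<omega>) * (\<omega> - cnj \<omega>)"
    unfolding at_u0 by (simp only: mult_minus_left mult_minus_right minus_minus right_diff_distrib
        left_diff_distrib mult_ac)
  finally show F0: "F (of_real u0) = of_real \<alpha> * (\<omega> - cnj \<omega>)"
    by (simp add: F_def slope_def DERIV_imp_deriv)
  show "F u \<noteq> 0" if "norm u \<le> 1"
    using D0_nz[of u] that F0 \<omega>_ne \<alpha>_nz at_u0(7)
    by (cases "u = of_real u0") (auto simp: F_def slope_def)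
qed

lemma u0_lt: "norm (complex_of_real u0) < 1"
  using u0 by simp

lemma cont_rp: "continuous_on (cball 0 1) (\<lambda>u. r u - p u)"
  and holo_rp: "(\<lambda>u. r u - p u) holomorphic_on ball 0 1"
  by (intro continuous_on_diff holomorphic_on_diff cont holo)+

lemma holo_EF: "E holomorphic_on ball 0 1" "F holomorphic_on ball 0 1"
  and cont_EF: "continuous_on (cball 0 1) E" "continuous_on (cball 0 1) F"
  unfolding E_def F_def
  by (rule slope_disc[OF cont_rp holo_rp] slope_disc[OF cont_D holo(5) u0_lt], simp?)+

end

section \<open>Faber-type polynomials of a lens\<close>

context lens begin

lemma D_diff: "D z u = D 0 u - z * (r u - p u)"
  by (simp add: D_def algebra_simps)

text \<open>This value is the residue of \<open>h z - h 0\<close> at \<open>u0\<close>. It does not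
  depend on \<open>z\<close>, as the factor \<open>z\<close> of the numerator cancels against
  \<open>D z u0 = z * (a - cnj a)\<close>; one pole term therefore serves the whole lens.\<close>

lemma M_u0:
  assumes z: "norm z < 1" "Re z > cos \<beta>"
  shows "M z (of_real u0) = of_real u0"
proof -
  have "cos \<beta> > 0" using \<beta> by (intro cos_gt_zero) auto
  then have z0: "z \<noteq> 0" using z by auto
  have "p1 (of_real u0) * r1 (of_real u0) = (a * cnj a) * (\<omega> * cnj \<omega>) * (\<omega> * cnj \<omega>)"
    unfolding at_u0 by (simp only: mult_ac mult_minus_left mult_minus_right minus_minus)
  then have 1: "p1 (of_real u0) * r1 (of_real u0) = 1" by simp
  have D: "D z (of_real u0) = z * (a - cnj a)"
    unfolding D_diff[of z] at_u0 by (simp add: algebra_simps)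
  have "M z (of_real u0) = \<kappa> * z * of_real u0 * (p1 (of_real u0) * r1 (of_real u0))
      / (of_real \<alpha> * (\<omega> - cnj \<omega>) * (z * (a - cnj a)))"
    unfolding M_def D F by (simp only: mult.assoc)
  also have "\<dots> = of_real u0"
    unfolding 1 \<kappa>_def using z0 a_ne \<omega>_ne \<alpha>_nz by (simp add: divide_simps)
  finally show ?thesis .
qed

lemma G_eq:
  assumes z: "norm z < 1" "Re z > cos \<beta>" and u: "u \<noteq> of_real u0"
  shows "G z u = \<kappa> * z * u * p1 u * r1 u / (D 0 u * D z u) + of_real u0 / (of_real u0 - u)"
proof -
  have u': "u - of_real u0 \<noteq> 0" "of_real u0 - u \<noteq> 0" using u by auto
  have "F u = D 0 u / (u - of_real u0)"
    using u at_u0(7) by (simp add: F_def slope_def)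
  then have "M z u / (u - of_real u0) = \<kappa> * z * u * p1 u * r1 u / (D 0 u * D z u)"
    using u' by (simp add: M_def)
  moreover have "- of_real u0 / (u - of_real u0) = of_real u0 / (of_real u0 - u)"
    using minus_divide_divide[of "of_real u0" "of_real u0 - u"] by simp
  ultimately show ?thesis
    using u M_u0[OF z] by (simp add: G_def slope_def diff_divide_distrib)
qed

text \<open>\<open>D z\<close> is affine in \<open>z\<close> with slope
  \<open>- (r u - p u)\<close>, so the difference of the two fractions loses the factor
  \<open>r u - p u\<close>, and with it the singularity at \<open>u = 0\<close>.\<close>

lemma h_diff:
  assumes u: "norm u = 1" and z: "norm z < 1" "Re z > cos \<beta>"
  shows "h z u - h 0 u = \<kappa> * z * u * p1 u * r1 u / (D 0 u * D z u)"
proof -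
  have "u \<noteq> of_real u0" "u \<noteq> 0" using u u0_lt by auto
  then have nz: "r u - p u \<noteq> 0" "D 0 u \<noteq> 0" "D z u \<noteq> 0"
    using rp_nz[of u] D0_nz[of u] D_nz[of u z] u z by auto
  have id: "c * x / (q * d) - c * x / (q * e) = c * w * x / (e * d)"
    if "q \<noteq> 0" "d \<noteq> 0" "e \<noteq> 0" "d = e - w * q" for c x q d e w :: complex
    using that(1-3) by (simp add: divide_simps) (simp add: that(4) algebra_simps)
  show ?thesis
    using id[of "r u - p u" "D z u" "D 0 u" z \<kappa> "u * p1 u * r1 u", OF nz(1,3,2) D_diff]
    by (simp add: h_def mult_ac)
qed

lemma H_eq: "norm u = 1 \<Longrightarrow> H z u = h z u"
  by (auto simp: H_def h_def E_def slope_def mult_ac)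

lemma
  assumes z: "norm z < 1" "Re z > cos \<beta>"
  shows H_cont: "continuous_on (cball 0 1) (H z)" and H_holo: "H z holomorphic_on ball 0 1"
    and H_0: "H z 0 = 1"
    and G_cont: "continuous_on (cball 0 1) (G z)" and G_holo: "G z holomorphic_on ball 0 1"
    and G_0: "G z 0 = 1"
proof -
  have nz: "D z u \<noteq> 0" "E u \<noteq> 0" "F u \<noteq> 0" if "norm u \<le> 1" for u
    using that D_nz[of u z] E(2)[of u] F(2)[of u] z by auto
  show "continuous_on (cball 0 1) (H z)"
    unfolding H_def
    by (intro continuous_on_divide continuous_on_mult continuous_on_const cont cont_D cont_EF)
       (use nz in simp)
  show "H z holomorphic_on ball 0 1"
    unfolding H_def
    by (intro holomorphic_on_divide holomorphic_on_mult holomorphic_on_const holo holo_EF)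
       (use nz in simp)
  have Mc: "continuous_on (cball 0 1) (M z)"
    unfolding M_def
    by (intro continuous_on_divide continuous_on_mult continuous_on_const continuous_on_id
          cont cont_D cont_EF)
       (use nz in simp)
  have Mh: "M z holomorphic_on ball 0 1"
    unfolding M_def
    by (intro holomorphic_on_divide holomorphic_on_mult holomorphic_on_const holomorphic_on_ident
          holo holo_EF)
       (use nz in simp)
  show "continuous_on (cball 0 1) (G z)" "G z holomorphic_on ball 0 1"
    unfolding G_def by (rule slope_disc[OF Mc Mh u0_lt])+
  show "H z 0 = 1"
    using \<alpha>_nz \<omega>_ne a_ne by (simp add: H_def E \<kappa>_def)
  show "G z 0 = 1"
    using u0 by (subst G_eq[OF z]) auto
qed

text \<open>After the denominator is cleared, only \<open>u0^2 \<le> 1\<close> remains.\<close>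

lemma Re_Pi_le:
  assumes "norm u = 1"
  shows "Re (of_real u0 / (of_real u0 - u)) \<le> 1 / 2"
proof -
  have ne: "of_real u0 - u \<noteq> 0" using assms u0_lt by auto
  have "(norm (of_real u0 - u))\<^sup>2 = u0\<^sup>2 - 2 * u0 * Re u + (norm u)\<^sup>2"
    unfolding cmod_power2 by (simp add: power2_eq_square algebra_simps)
  then have eq: "(norm (of_real u0 - u))\<^sup>2 = u0\<^sup>2 - 2 * u0 * Re u + 1" using assms by simp
  have "u0\<^sup>2 \<le> 1" using u0 by (simp add: abs_square_le_1)
  have "Re (of_real u0 / (of_real u0 - u)) = u0 * (u0 - Re u) / (norm (of_real u0 - u))\<^sup>2"
    by (simp add: Re_divide cmod_power2)
  also have "\<dots> \<le> 1 / 2"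
  proof -
    have pos: "(norm (of_real u0 - u))\<^sup>2 > 0" using ne by simp
    have "u0 * (u0 - Re u) \<le> 1 / 2 * (u0\<^sup>2 - 2 * u0 * Re u + 1)"
      using \<open>u0\<^sup>2 \<le> 1\<close> by (simp add: power2_eq_square algebra_simps)
    then show ?thesis
      using pos unfolding eq by (simp only: divide_le_eq if_True)
  qed
  finally show ?thesis .
qed

text \<open>On the circle \<open>\<bar>x - y\<bar> \<le> 3 * x - y\<close> for \<open>x = Re (h z u)\<close>, \<open>y = Re (h 0 u)\<close>. The majorant
  \<open>B\<close> has mean 4; its last term has the real part of \<open>u0 / (u0 - u)\<close> on the circle but, unlike
  the latter, is holomorphic in the disc.\<close>

lemma G_coeff_bound:
  assumes z: "norm z < 1" "Re z > cos \<beta>" and k: "k > 0"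
  shows "norm ((deriv ^^ k) (G z) 0 / fact k) \<le> 8"
proof -
  define B where "B u = 2 * H z u + G z u + 1 - 2 * (of_real u0 * u / (of_real u0 * u - 1))" for u
  have nz: "complex_of_real u0 * u - 1 \<noteq> 0" if "norm u \<le> 1" for u
  proof
    assume "complex_of_real u0 * u - 1 = 0"
    then have "norm (complex_of_real u0 * u) = 1" by simp
    moreover have "norm (complex_of_real u0 * u) \<le> \<bar>u0\<bar> * 1"
      unfolding norm_mult using that by (intro mult_mono) auto
    ultimately show False using u0 by simp
  qed
  have "continuous_on (cball 0 1) B"
    unfolding B_def
    by (intro continuous_intros H_cont G_cont z) (use nz in simp)
  moreover have "B holomorphic_on ball 0 1"
    unfolding B_def
    by (intro holomorphic_intros H_holo G_holo z) (use nz in simp)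
  moreover have "\<bar>Re (G z u)\<bar> \<le> Re (B u)" if u: "norm u = 1" for u
  proof -
    define P where "P = of_real u0 / (of_real u0 - u)"
    have "u \<noteq> of_real u0" using u u0_lt by auto
    then have G: "G z u = h z u - h 0 u + P"
      unfolding P_def h_diff[OF u z] by (rule G_eq[OF z])
    have uc: "u * cnj u = 1" using u by (simp add: complex_norm_square[symmetric])
    have "u \<noteq> 0" using u by auto
    have "cnj P = of_real u0 / (of_real u0 - cnj u)" by (simp add: P_def)
    also have "\<dots> = (u * of_real u0) / (u * (of_real u0 - cnj u))"
      using \<open>u \<noteq> 0\<close> by simp
    also have "\<dots> = of_real u0 * u / (of_real u0 * u - 1)"
      unfolding right_diff_distrib uc by (simp only: mult.commute)
    finally have "Re (of_real u0 * u / (of_real u0 * u - 1)) = Re P" by (metis complex_cnj(1) cnj.sel(1))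
    moreover have "Re (2 * x + y + 1 - 2 * w) = 2 * Re x + Re y + 1 - 2 * Re w" for x y w :: complex
      by simp
    ultimately have "Re (B u) = 2 * Re (h z u) + Re (G z u) + 1 - 2 * Re P"
      unfolding B_def H_eq[OF u] by (simp only:)
    moreover have "Re (G z u) = Re (h z u) - Re (h 0 u) + Re P" unfolding G by simp
    moreover have "Re P \<le> 1/2" unfolding P_def by (rule Re_Pi_le[OF u])
    ultimately show ?thesis using boundary_ineq[OF u z] by linarith
  qed
  ultimately have "norm ((deriv ^^ k) (G z) 0 / fact k) \<le> 2 * Re (B 0)"
    using G_cont[OF z] G_holo[OF z] k by (intro coeff_le_of_Re_le)
  also have "B 0 = 4" using H_0[OF z] G_0[OF z] by (simp add: B_def)
  finally show ?thesis by simp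
qed

lemma fps_geom:
  fixes c :: complex
  shows "Abs_fps (\<lambda>k. c ^ k) * (1 - fps_const c * fps_X) = 1"
proof (rule fps_ext)
  fix n show "fps_nth (Abs_fps (\<lambda>k. c ^ k) * (1 - fps_const c * fps_X)) n = fps_nth 1 n"
    by (cases n) (simp_all add: right_diff_distrib mult.assoc[symmetric] fps_mult_right_const_nth)
qed

text \<open>Multiplying \<open>G z\<close> by \<open>(1 - u / u0) * D 0 u * D z u\<close> makes the
  right-hand side affine in \<open>z\<close>, like the multiplier itself. The part of the multiplier
  linear in \<open>z\<close> carries the factor \<open>r - p\<close>, which vanishes at
  \<open>u = 0\<close>, so the coefficient recursion applies.\<close>

lemma G_coeff_poly:
  "\<exists>Q. degree Q \<le> k \<and> poly Q 0 = (1 / of_real u0) ^ k \<and>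
     (\<forall>z. norm z < 1 \<and> Re z > cos \<beta> \<longrightarrow> (deriv ^^ k) (G z) 0 / fact k = poly Q z)"
proof -
  define W where "W = fps_expansion (D 0) 0"
  define V where "V = fps_expansion (\<lambda>u. r u - p u) 0"
  define N where "N = fps_expansion (\<lambda>u. p1 u * r1 u) 0"
  define L where "L = 1 - fps_const (1 / complex_of_real u0) * fps_X"
  have W: "D 0 has_fps_expansion W"
    unfolding W_def by (rule has_fps_expansion_fps_expansion[of "ball 0 1"]) (auto intro: holo)
  have V: "(\<lambda>u. r u - p u) has_fps_expansion V"
    unfolding V_def by (rule has_fps_expansion_fps_expansion[of "ball 0 1"]) (auto intro: holo_rp)
  have N: "(\<lambda>u. p1 u * r1 u) has_fps_expansion N"
    unfolding N_def
    by (rule has_fps_expansion_fps_expansion[of "ball 0 1"]) (auto intro!: holo holomorphic_on_mult)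
  have L: "(\<lambda>u. 1 - 1 / of_real u0 * u) has_fps_expansion L"
    unfolding L_def by (intro fps_expansion_intros)
  have W0: "fps_nth W 0 \<noteq> 0" using W a_ne by (simp add: has_fps_expansion_imp_0_eq_fps_nth_0[symmetric])
  have V0: "fps_nth V 0 = 0" using V by (simp add: has_fps_expansion_imp_0_eq_fps_nth_0[symmetric])
  have L0: "fps_nth L 0 = 1" by (simp add: L_def)
  have "\<exists>Q. degree Q \<le> k \<and> (\<forall>z g. g * (L * W * W - fps_const z * (L * W * V)) =
      W * W - fps_const z * (W * V - fps_const \<kappa> * fps_X * N * L) \<longrightarrow> fps_nth g k = poly Q z)"
    using W0 V0 L0 by (intro fps_coeff_poly) (simp_all add: mult.assoc)
  then obtain Q where deg: "degree Q \<le> k"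
    and Q: "\<And>z g. g * (L * W * W - fps_const z * (L * W * V)) =
      W * W - fps_const z * (W * V - fps_const \<kappa> * fps_X * N * L) \<Longrightarrow> fps_nth g k = poly Q z"
    by blast
  \<comment> \<open>As 0 is outside the lens, the value at 0 is taken from the formal equation: for
    \<open>z = 0\<close> it reads \<open>g * (L * W * W) = W * W\<close>, solved by the geometric
    series with ratio \<open>1 / u0\<close>.\<close>
  have "fps_nth (Abs_fps (\<lambda>k. (1 / complex_of_real u0) ^ k)) k = poly Q 0"
    using fps_geom[of "1 / complex_of_real u0"] by (intro Q) (simp add: L_def mult.assoc[symmetric])
  moreover have "(deriv ^^ k) (G z) 0 / fact k = poly Q z" if z: "norm z < 1" "Re z > cos \<beta>" for z
  proof -
    define g where "g = fps_expansion (G z) 0"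
    have g: "G z has_fps_expansion g"
      unfolding g_def by (rule has_fps_expansion_fps_expansion[of "ball 0 1"]) (auto intro: G_holo[OF z])
    have ex1: "(\<lambda>u. G z u * ((1 - 1 / of_real u0 * u) * D 0 u * D 0 u - z * ((1 - 1 / of_real u0 * u) * D 0 u * (r u - p u))))
      has_fps_expansion g * (L * W * W - fps_const z * (L * W * V))"
      by (intro fps_expansion_intros g L W V)
    have ex2: "(\<lambda>u. D 0 u * D 0 u - z * (D 0 u * (r u - p u) - \<kappa> * u * (p1 u * r1 u) * (1 - 1 / of_real u0 * u)))
      has_fps_expansion W * W - fps_const z * (W * V - fps_const \<kappa> * fps_X * N * L)"
      by (intro fps_expansion_intros L W V N)
    have ev: "eventually (\<lambda>u. G z u * ((1 - 1 / of_real u0 * u) * D 0 u * D 0 u - z * ((1 - 1 / of_real u0 * u) * D 0 u * (r u - p u)))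
       = D 0 u * D 0 u - z * (D 0 u * (r u - p u) - \<kappa> * u * (p1 u * r1 u) * (1 - 1 / of_real u0 * u))) (nhds 0)"
    proof -
      have "eventually (\<lambda>u. u \<in> ball 0 1 - {complex_of_real u0}) (nhds 0)"
        using u0 by (intro eventually_nhds_in_open) auto
      then show ?thesis
      proof eventually_elim
        case (elim u)
        then have nz: "D 0 u \<noteq> 0" "D z u \<noteq> 0" "of_real u0 - u \<noteq> 0" "complex_of_real u0 \<noteq> 0"
          using D0_nz[of u] D_nz[of u z] z u0 by auto
        have id: "(c * z * x / (e * d) + v / (v - u)) * ((1 - 1 / v * u) * e * e - z * ((1 - 1 / v * u) * e * q)) =
            e * e - z * (e * q - c * x * (1 - 1 / v * u))"
          if "e \<noteq> 0" "d \<noteq> 0" "v - u \<noteq> 0" "v \<noteq> 0" "d = e - z * q" for c x e d v q :: complex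
        proof -
          have T: "1 - 1 / v * u \<noteq> 0" "v / (v - u) = 1 / (1 - 1 / v * u)"
            using that by (simp_all add: field_simps)
          have cancel: "(X / Y + 1 / t) * (t * Y) = X * t + Y" if "t \<noteq> 0" "Y \<noteq> 0" for X Y t :: complex
            using that by (simp add: field_simps)
          have "(1 - 1 / v * u) * e * e - z * ((1 - 1 / v * u) * e * q) = (1 - 1 / v * u) * (e * d)"
            unfolding that(5) by (simp add: algebra_simps)
          then have "(c * z * x / (e * d) + v / (v - u)) * ((1 - 1 / v * u) * e * e - z * ((1 - 1 / v * u) * e * q))
            = c * z * x * (1 - 1 / v * u) + e * d"
            using cancel[OF T(1), of "e * d" "c * z * x"] that(1,2) T(2) by simp
          then show ?thesis unfolding that(5) by (simp add: algebra_simps)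
        qed
        have Gu: "G z u = \<kappa> * z * (u * (p1 u * r1 u)) / (D 0 u * D z u) + of_real u0 / (of_real u0 - u)"
          using G_eq[OF z, of u] nz by (simp add: mult_ac)
        show ?case unfolding Gu
          by (subst id[OF nz(1,2,3,4) D_diff]) (simp only: mult_ac)
      qed
    qed
    have "g * (L * W * W - fps_const z * (L * W * V)) =
        W * W - fps_const z * (W * V - fps_const \<kappa> * fps_X * N * L)"
      using fps_expansion_unique_complex[OF iffD1[OF has_fps_expansion_cong[OF ev refl] ex1] ex2] .
    from Q[OF this] show ?thesis by (simp add: g_def fps_expansion_def)
  qed
  ultimately show ?thesis using deg by auto
qed

end

theorem lens_polynomial:
  assumes \<beta>: "0 < \<beta>" "\<beta> < pi / 2"
  obtains q where "degree q \<le> k" "poly q 0 = 1"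
    "\<And>z :: complex. norm z < 1 \<Longrightarrow> Re z > cos \<beta> \<Longrightarrow> norm (poly q z) \<le> 8 * (2 * sin (\<beta> / (4 - 2 * \<beta> / pi))) ^ k"
proof (cases "k = 0")
  case True
  \<comment> \<open>The coefficient bound is for positive index only; for \<open>k = 0\<close> the
    constant 1 is below 8.\<close>
  then show ?thesis by (intro that[of 1]) auto
next
  case False
  interpret lens \<beta> using \<beta> by unfold_locales
  obtain Q where Q: "degree Q \<le> k" "poly Q 0 = (1 / of_real u0) ^ k"
     "\<And>z. norm z < 1 \<Longrightarrow> Re z > cos \<beta> \<Longrightarrow> (deriv ^^ k) (G z) 0 / fact k = poly Q z"
    using G_coeff_poly[of k] by blast
  have n: "norm (complex_of_real u0 ^ k) = \<gamma> ^ k"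
    using \<gamma> by (simp add: norm_power)
  show ?thesis
  proof (rule that[of "smult (of_real u0 ^ k) Q"])
    show "degree (smult (of_real u0 ^ k) Q) \<le> k"
      using Q(1) degree_smult_le order.trans by blast
    show "poly (smult (of_real u0 ^ k) Q) 0 = 1"
      using Q(2) u0 by (simp add: power_divide)
    fix z :: complex assume z: "norm z < 1" "Re z > cos \<beta>"
    have "norm (poly Q z) \<le> 8"
      using G_coeff_bound[OF z, of k] False Q(3)[OF z] by simp
    then have "norm (poly Q z) * \<gamma> ^ k \<le> 8 * \<gamma> ^ k"
      using \<gamma> by (intro mult_right_mono) auto
    then show "norm (poly (smult (of_real u0 ^ k) Q) z) \<le>
        8 * (2 * sin (\<beta> / (4 - 2 * \<beta> / pi))) ^ k"
      unfolding \<gamma>_eq[symmetric] by (simp add: norm_mult n mult.commute)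
  qed
qed

section \<open>GMRES and spectral decomposition\<close>

lemma norm_vector_scalar_mult: "norm (c *s (x :: complex ^ 'n)) = norm c * norm x"
  by (simp add: norm_vec_def norm_mult L2_set_right_distrib)

lemma norm_sum_mult_le:
  fixes x y :: "complex ^ 'n"
  shows "norm (\<Sum>i\<in>UNIV. x $ i * y $ i) \<le> norm x * norm y"
proof -
  have "norm (\<Sum>i\<in>UNIV. x $ i * y $ i) \<le> (\<Sum>i\<in>UNIV. \<bar>norm (x $ i)\<bar> * \<bar>norm (y $ i)\<bar>)"
    by (rule order.trans[OF norm_sum]) (simp add: norm_mult)
  also have "\<dots> \<le> norm x * norm y"
    unfolding norm_vec_def by (rule L2_set_mult_ineq)
  finally show ?thesis .
qed

lemma eigenvalue_le_spec_norm:
  assumes "\<mu> \<in> eigenvalues B"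
  shows "norm \<mu> \<le> spec_norm B"
proof -
  obtain v where v: "v \<noteq> 0" "B *v v = \<mu> *s v" using assms by (auto simp: eigenvalues_def)
  have "norm (B *v v) \<le> onorm (\<lambda>x. B *v x) * norm v"
    by (rule onorm) (rule matrix_vector_mul_bounded_linear)
  then show ?thesis using v by (simp add: norm_vector_scalar_mult spec_norm_def)
qed

text \<open>This is the vector \<open>p(B) v\<close>, written in Krylov vectors so that it compares
  term by term with GMRES iterates.\<close>

definition poly_krylov :: "complex poly \<Rightarrow> complex ^ 'n ^ 'n \<Rightarrow> complex ^ 'n \<Rightarrow> complex ^ 'n" where
  "poly_krylov p B v = (\<Sum>k\<le>degree p. coeff p k *s krylov_vec B v k)"

lemma gmres_res_norm_le_poly:
  fixes B :: "complex ^ 'n ^ 'n"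
  assumes p: "degree p \<le> m" "poly p 0 = 1"
  shows "gmres_res_norm B b x0 m \<le> norm (poly_krylov p B (b - B *v x0))"
proof -
  define v where "v = b - B *v x0"
  have "poly_krylov p B v = (\<Sum>k\<le>m. coeff p k *s krylov_vec B v k)"
    unfolding poly_krylov_def using p(1)
    by (intro sum.mono_neutral_left) (auto simp: not_le coeff_eq_0)
  also have "\<dots> = coeff p 0 *s krylov_vec B v 0 + (\<Sum>k<m. coeff p (Suc k) *s krylov_vec B v (Suc k))"
    by (simp add: sum.atMost_shift)
  also have "\<dots> = v + (\<Sum>k<m. coeff p (Suc k) *s (B *v krylov_vec B v k))"
    using p(2) by (simp add: krylov_vec_def poly_0_coeff_0)
  \<comment> \<open>Every term beyond the constant one contains a factor \<open>B\<close>. Pulling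
    it out shifts the index by one, so degree \<open>m\<close> uses exactly the \<open>m\<close>
    Krylov vectors available.\<close>
  also have "\<dots> = b - B *v (x0 + (\<Sum>k<m. (- coeff p (Suc k)) *s krylov_vec B v k))"
    by (simp add: v_def matrix_vector_right_distrib matrix_vector_mult_diff_distrib vec.sum
          vector_scalar_commute sum_negf vec.scale_minus_left)
  finally have "norm (poly_krylov p B v) =
      norm (b - B *v (x0 + (\<Sum>k<m. (- coeff p (Suc k)) *s krylov_vec B v k)))"
    by (rule arg_cong)
  then have "norm (poly_krylov p B v) \<in> {norm (b - B *v x) | x. \<exists>c :: nat \<Rightarrow> complex.
            x = x0 + (\<Sum>k<m. c k *s krylov_vec B (b - B *v x0) k)}"
    unfolding v_def by (intro CollectI exI conjI) (assumption, rule refl)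
  then show ?thesis
    unfolding gmres_res_norm_def v_def by (rule cInf_lower) (auto intro!: bdd_belowI[of _ 0])
qed

text \<open>The columns of \<open>P\<close> are right eigenvectors, the rows of \<open>Q\<close> the
  left eigenvectors dual to them. Keeping \<open>Q\<close> as a parameter lets the transpose be an
  instance, with \<open>P\<close> and \<open>Q\<close> exchanging roles.\<close>

locale diagonalisation =
  fixes B P D Q :: "complex ^ 'n ^ 'n"
  assumes PQ: "P ** Q = mat 1" and QP: "Q ** P = mat 1"
    and diag: "\<And>i j. i \<noteq> j \<Longrightarrow> D $ i $ j = 0"
    and B: "B = P ** D ** Q"
begin

definition "d i = D $ i $ i"

lemma D_vec: "(D *v x) $ i = d i * x $ i"
proof -
  have "D $ i $ j * x $ j = (if j = i then d i * x $ i else 0)" for j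
    using diag[of i j] by (auto simp: d_def)
  then show ?thesis by (simp add: matrix_vector_mult_def)
qed

lemma Q_B: "Q *v (B *v x) = D *v (Q *v x)"
  unfolding B matrix_vector_mul_assoc by (simp add: matrix_mul_assoc QP)

lemma P_Q_vec: "P *v (Q *v x) = x"
  by (simp add: matrix_vector_mul_assoc PQ)

lemma expand: "x = (\<Sum>i\<in>UNIV. (Q *v x) $ i *s column i P)"
  using matrix_mult_sum[of P "Q *v x"] by (simp add: P_Q_vec)

lemma Q_krylov: "(Q *v krylov_vec B x k) $ i = d i ^ k * (Q *v x) $ i"
  by (induction k) (simp_all add: krylov_vec_def Q_B D_vec)

lemma Q_nth: "(Q *v x) $ i = (\<Sum>j\<in>UNIV. row i Q $ j * x $ j)"
  by (simp add: matrix_vector_mult_def row_def)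

lemma poly_krylov_expand:
  "poly_krylov p B x = (\<Sum>i\<in>UNIV. (poly p (d i) * (Q *v x) $ i) *s column i P)"
proof -
  have "(Q *v poly_krylov p B x) $ i = poly p (d i) * (Q *v x) $ i" for i
    unfolding poly_krylov_def
    by (simp add: vec.sum vector_scalar_commute Q_krylov poly_altdef sum_distrib_right mult.assoc)
  then show ?thesis using expand[of "poly_krylov p B x"] by simp
qed

lemma norm_poly_krylov_le:
  "norm (poly_krylov p B x) \<le> (\<Sum>i\<in>UNIV. norm (poly p (d i)) * (norm (column i P) * norm (row i Q))) * norm x"
proof -
  have "norm (poly_krylov p B x) \<le>
      (\<Sum>i\<in>UNIV. norm (poly p (d i)) * norm ((Q *v x) $ i) * norm (column i P))"
    unfolding poly_krylov_expand
    by (rule order.trans[OF norm_sum]) (simp add: norm_vector_scalar_mult norm_mult)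
  also have "\<dots> \<le> (\<Sum>i\<in>UNIV. norm (poly p (d i)) * (norm (row i Q) * norm x) * norm (column i P))"
    unfolding Q_nth by (intro sum_mono mult_left_mono mult_right_mono norm_sum_mult_le) auto
  also have "\<dots> = (\<Sum>i\<in>UNIV. norm (poly p (d i)) * (norm (column i P) * norm (row i Q))) * norm x"
    by (subst sum_distrib_right) (simp only: mult_ac)
  finally show ?thesis .
qed

lemma row_column: "(\<Sum>j\<in>UNIV. row i Q $ j * column i P $ j) = 1"
proof -
  have "(Q ** P) $ i $ i = 1" by (simp add: QP mat_def)
  then show ?thesis by (simp add: matrix_matrix_mult_def row_def column_def)
qed

lemma column_nz: "column i P \<noteq> 0" and row_nz: "row i Q \<noteq> 0"
  using row_column[of i] by auto

lemma B_column: "B *v column i P = d i *s column i P"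
proof -
  have Qc: "(Q *v column i P) $ j = (if i = j then 1 else 0)" for j
  proof -
    have "(Q ** P) $ j $ i = (if i = j then 1 else 0)" by (simp add: QP mat_def)
    then show ?thesis by (simp add: matrix_matrix_mult_def matrix_vector_mult_def column_def)
  qed
  have "Q *v (B *v column i P) = Q *v (d i *s column i P)"
    by (simp add: Q_B vec_eq_iff D_vec vector_scalar_commute Qc)
  then have "P *v (Q *v (B *v column i P)) = P *v (Q *v (d i *s column i P))" by (rule arg_cong)
  then show ?thesis by (simp only: P_Q_vec)
qed

lemma eigenvalues_eq: "eigenvalues B = range d"
proof
  show "range d \<subseteq> eigenvalues B"
    using B_column column_nz by (auto simp: eigenvalues_def)
  show "eigenvalues B \<subseteq> range d"
  proof
    fix \<mu> assume "\<mu> \<in> eigenvalues B"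
    then obtain v where v: "v \<noteq> 0" "B *v v = \<mu> *s v" by (auto simp: eigenvalues_def)
    have "Q *v v \<noteq> 0"
      using v(1) P_Q_vec[of v] by auto
    then obtain i where i: "(Q *v v) $ i \<noteq> 0" by (auto simp: vec_eq_iff)
    have "d i * (Q *v v) $ i = \<mu> * (Q *v v) $ i"
      using arg_cong[OF v(2), of "\<lambda>x. (Q *v x) $ i"] by (simp add: Q_B D_vec vector_scalar_commute)
    then show "\<mu> \<in> range d" using i by auto
  qed
qed

lemma char_poly: "det (mat x - B) = (\<Prod>i\<in>UNIV. x - d i)"
proof -
  have "(mat x - B) ** P = P ** (mat x - D)"
  proof -
    have "B ** P = P ** D"
      unfolding B by (simp add: matrix_mul_assoc[symmetric] QP)
    moreover have "mat x ** P = P ** mat x"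
      by (simp add: matrix_matrix_mult_def mat_def vec_eq_iff if_distrib if_distribR mult.commute cong: if_cong)
    moreover have "(mat x - B) ** P = mat x ** P - B ** P"
      by (simp add: matrix_matrix_mult_def vec_eq_iff left_diff_distrib sum_subtractf)
    moreover have "P ** (mat x - D) = P ** mat x - P ** D"
      by (simp add: matrix_matrix_mult_def vec_eq_iff right_diff_distrib sum_subtractf)
    ultimately show ?thesis by simp
  qed
  then have "det (mat x - B) * det P = det P * det (mat x - D)"
    by (metis det_mul)
  moreover have "det P \<noteq> 0"
    using PQ det_mul[of P Q] by auto
  moreover have "det (mat x - D) = (\<Prod>i\<in>UNIV. x - d i)"
    by (subst det_diagonal) (auto simp: mat_def d_def diag)
  ultimately show ?thesis by simp
qed

text \<open>A repeated diagonal entry would give the characteristic polynomial a root of order at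
  least 2.\<close>

lemma inj_d:
  assumes "\<And>\<mu>. \<mu> \<in> eigenvalues B \<Longrightarrow> simple_eigenvalue B \<mu>"
  shows "inj d"
proof (rule injI, rule ccontr)
  fix i j assume ij: "d i = d j" "i \<noteq> j"
  obtain p where p: "\<And>x. poly p x = det (mat x - B)" "order (d i) p = 1"
    using assms[of "d i"] by (auto simp: eigenvalues_eq simple_eigenvalue_def)
  have "poly p x = poly (\<Prod>k\<in>UNIV. [:- d k, 1:]) x" for x
    by (simp add: p(1) char_poly poly_prod)
  then have p_eq: "p = (\<Prod>k\<in>UNIV. [:- d k, 1:])"
    by (simp add: poly_eq_poly_eq_iff[symmetric] fun_eq_iff)
  have "[:- d i, 1:] ^ 2 = (\<Prod>k\<in>{i, j}. [:- d k, 1:])"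
    using ij by (simp add: power2_eq_square)
  also have "\<dots> dvd p" unfolding p_eq by (rule prod_dvd_prod_subset) auto
  finally have "p = 0 \<or> 2 \<le> order (d i) p" by (simp only: order_divides)
  moreover have "p \<noteq> 0" unfolding p_eq by (simp add: prod_zero_iff)
  ultimately show False using p(2) by simp
qed

lemma eigenvector_unique:
  assumes "inj d" "B *v v = d i *s v"
  shows "v = (Q *v v) $ i *s column i P"
proof -
  have "(Q *v v) $ j = 0" if "j \<noteq> i" for j
  proof -
    have "d j * (Q *v v) $ j = d i * (Q *v v) $ j"
      using arg_cong[OF assms(2), of "\<lambda>x. (Q *v x) $ j"] by (simp add: Q_B D_vec vector_scalar_commute)
    then show ?thesis using injD[OF assms(1), of i j] that by auto
  qed
  then have "(\<Sum>j\<in>UNIV. (Q *v v) $ j *s column j P) =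
      (\<Sum>j\<in>UNIV. if j = i then (Q *v v) $ i *s column i P else 0)"
    by (intro sum.cong) auto
  then show ?thesis using expand[of v] by simp
qed

end

text \<open>Left eigenvectors of \<open>B\<close> are right eigenvectors of its transpose, so facts
  on right eigenvectors carry over to them.\<close>

lemma (in diagonalisation) transpose: "diagonalisation (transpose B) (transpose Q) (transpose D) (transpose P)"
proof
  show "transpose Q ** transpose P = mat 1" "transpose P ** transpose Q = mat 1"
    using PQ QP by (simp_all flip: matrix_transpose_mul)
  show "transpose D $ i $ j = 0" if "i \<noteq> j" for i j
    using diag that by (simp add: transpose_def)
  show "transpose B = transpose Q ** transpose D ** transpose P"
    unfolding B by (simp add: matrix_transpose_mul matrix_mul_assoc)
qed

text \<open>Eigenvectors of a simple eigenvalue are unique up to scalars, which cancel in the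
  quotient; the dual pair from \<open>P\<close> and \<open>Q\<close> has pairing 1. So the choice in
  the definition has only one candidate.\<close>

lemma (in diagonalisation) eig_cond_eq:
  assumes "inj d"
  shows "eig_cond B (d i) = norm (column i P) * norm (row i Q)"
  unfolding eig_cond_def
proof (rule some_equality)
  interpret T: diagonalisation "transpose B" "transpose Q" "transpose D" "transpose P"
    by (rule transpose)
  have Td: "T.d = d" unfolding T.d_def[abs_def] d_def[abs_def] by (simp add: transpose_def)
  have rc: "(\<Sum>j\<in>UNIV. column i P $ j * row i Q $ j) = 1"
    using row_column[of i] by (simp add: mult.commute)
  have "transpose B *v row i Q = d i *s row i Q"
    using T.B_column[of i] by (simp add: Td)
  then have "row i Q v* B = d i *s row i Q" by simp
  then show "\<exists>u v. u \<noteq> 0 \<and> v \<noteq> 0 \<and> B *v u = d i *s u \<and> v v* B = d i *s v \<and>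
      norm (column i P) * norm (row i Q) = norm u * norm v / cmod (\<Sum>i\<in>UNIV. u $ i * v $ i)"
    using rc B_column column_nz row_nz
    by (intro exI[of _ "column i P"] exI[of _ "row i Q"]) simp
  fix k
  assume "\<exists>u v. u \<noteq> 0 \<and> v \<noteq> 0 \<and> B *v u = d i *s u \<and> v v* B = d i *s v \<and>
      k = norm u * norm v / cmod (\<Sum>i\<in>UNIV. u $ i * v $ i)"
  then obtain u v where uv: "u \<noteq> 0" "v \<noteq> 0" "B *v u = d i *s u" "v v* B = d i *s v"
    "k = norm u * norm v / cmod (\<Sum>i\<in>UNIV. u $ i * v $ i)" by blast
  obtain c where u: "u = c *s column i P"
    using eigenvector_unique[OF assms uv(3)] by blast
  have "transpose B *v v = T.d i *s v" using uv(4) by (simp add: Td)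
  then obtain e where v: "v = e *s row i Q"
    using T.eigenvector_unique[of v i] assms by (auto simp: Td)
  have "(\<Sum>j\<in>UNIV. u $ j * v $ j) = c * e * (\<Sum>j\<in>UNIV. column i P $ j * row i Q $ j)"
    by (simp add: u v sum_distrib_left mult_ac)
  moreover have "c \<noteq> 0" "e \<noteq> 0" using uv(1,2) u v by auto
  ultimately show "k = norm (column i P) * norm (row i Q)"
    using uv(5) by (simp add: rc norm_mult u v norm_vector_scalar_mult)
qed

lemma (in diagonalisation) eig_cond_ge_1:
  assumes "inj d"
  shows "eig_cond B (d i) \<ge> 1"
  unfolding eig_cond_eq[OF assms]
  using norm_sum_mult_le[of "row i Q" "column i P"] row_column[of i] by (simp add: mult.commute)

lemma poly_krylov_le_eig_cond:
  fixes B :: "complex ^ 'n ^ 'n"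
  assumes "diagonalisable B" "\<forall>\<mu>\<in>eigenvalues B. simple_eigenvalue B \<mu>"
  defines "\<kappa> \<equiv> Max (eig_cond B ` eigenvalues B)"
  shows "finite (eigenvalues B)" "\<kappa> \<ge> 1"
    "(\<And>\<mu>. \<mu> \<in> eigenvalues B \<Longrightarrow> norm (poly p \<mu>) \<le> M) \<Longrightarrow>
      norm (poly_krylov p B x) \<le> real CARD('n) * \<kappa> * M * norm x"
proof -
  obtain P D :: "complex ^ 'n ^ 'n"
    where PD: "invertible P" "\<And>i j. i \<noteq> j \<Longrightarrow> D $ i $ j = 0" "B = P ** D ** matrix_inv P"
    using assms(1) by (auto simp: diagonalisable_def)
  have "P ** matrix_inv P = mat 1 \<and> matrix_inv P ** P = mat 1"
    unfolding matrix_inv_def by (rule someI_ex[OF PD(1)[unfolded invertible_def]])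
  then interpret diagonalisation B P D "matrix_inv P"
    using PD by unfold_locales auto
  have inj: "inj d" using assms(2) by (intro inj_d) auto
  show fin: "finite (eigenvalues B)" by (simp add: eigenvalues_eq)
  have \<kappa>: "eig_cond B (d i) \<le> \<kappa>" for i
    unfolding \<kappa>_def using fin by (intro Max_ge) (auto simp: eigenvalues_eq)
  show \<kappa>1: "\<kappa> \<ge> 1"
    \<comment> \<open>Any index serves; \<open>undefined\<close> only names an element of the index
      type.\<close>
    using \<kappa>[of undefined] eig_cond_ge_1[OF inj, of undefined] by simp
  assume M: "\<And>\<mu>. \<mu> \<in> eigenvalues B \<Longrightarrow> norm (poly p \<mu>) \<le> M"
  have M': "norm (poly p (d i)) \<le> M" for i by (rule M) (simp add: eigenvalues_eq)
  then have "M \<ge> 0" using norm_ge_zero order.trans by blast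
  then have "(\<Sum>i\<in>UNIV. norm (poly p (d i)) * (norm (column i P) * norm (row i (matrix_inv P)))) \<le>
      (\<Sum>i\<in>(UNIV :: 'n set). M * \<kappa>)"
    using M' \<kappa> unfolding eig_cond_eq[OF inj] by (intro sum_mono mult_mono) auto
  also have "\<dots> = real CARD('n) * \<kappa> * M" by simp
  finally show "norm (poly_krylov p B x) \<le> real CARD('n) * \<kappa> * M * norm x"
    using norm_poly_krylov_le[of p x] by (meson mult_right_mono norm_ge_zero order.trans)
qed

section \<open>The convergence estimate\<close>

lemma arccos_acute:
  assumes "0 < x" "x < 1"
  shows "0 < arccos x" "arccos x < pi / 2"
  using arccos_less_arccos[of x 1] arccos_less_arccos[of 0 x] assms by simp_all

lemma lens_rate:
  assumes "0 < \<beta>" "\<beta> < pi / 2"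
  shows "0 < 2 * sin (\<beta> / (4 - 2 * \<beta> / pi))" "2 * sin (\<beta> / (4 - 2 * \<beta> / pi)) < 1"
proof -
  interpret lens \<beta> using assms by unfold_locales
  show "0 < 2 * sin (\<beta> / (4 - 2 * \<beta> / pi))" "2 * sin (\<beta> / (4 - 2 * \<beta> / pi)) < 1"
    using \<gamma> by (simp_all only: \<gamma>_eq[symmetric])
qed

text \<open>A factor \<open>1 - z / \<mu>\<close> is at most \<open>2 * R / |\<mu>|\<close>, as both
  points have modulus below \<open>R\<close>. The deflation uses up \<open>card \<Lambda>\<close> of
  the degree, which is why the rate has exponent \<open>m - card \<Lambda>\<close>.\<close>

lemma deflated_polynomial:
  fixes \<Lambda> :: "complex set"
  assumes R: "0 < L" "L < R" and fin: "finite \<Lambda>"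
    and \<Lambda>: "\<And>\<mu>. \<mu> \<in> \<Lambda> \<Longrightarrow> \<mu> \<noteq> 0 \<and> norm \<mu> < R"
    and m: "card \<Lambda> \<le> m"
  defines "\<beta> \<equiv> arccos (L / R)"
  obtains p where "degree p \<le> m" "poly p 0 = 1" "\<And>\<mu>. \<mu> \<in> \<Lambda> \<Longrightarrow> poly p \<mu> = 0"
    "\<And>z. norm z < R \<Longrightarrow> Re z > L \<Longrightarrow> norm (poly p z) \<le>
      8 * (2 * sin (\<beta> / (4 - 2 * \<beta> / pi))) ^ (m - card \<Lambda>) *
        (\<Prod>\<mu>\<in>\<Lambda>. 1 / norm \<mu>) * (2 * R) ^ card \<Lambda>"
proof -
  have "0 < \<beta>" "\<beta> < pi / 2"
    using arccos_acute[of "L / R"] R by (simp_all add: \<beta>_def)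
  then obtain q :: "complex poly" where q: "degree q \<le> m - card \<Lambda>" "poly q 0 = 1"
    "\<And>z. norm z < 1 \<Longrightarrow> Re z > cos \<beta> \<Longrightarrow>
      norm (poly q z) \<le> 8 * (2 * sin (\<beta> / (4 - 2 * \<beta> / pi))) ^ (m - card \<Lambda>)"
    by (rule lens_polynomial[of \<beta> "m - card \<Lambda>"]) blast
  have "- 1 \<le> L / R" "L / R \<le> 1" using R divide_pos_pos[of L R] by (auto simp del: divide_pos_pos)
  then have cos: "cos \<beta> = L / R" by (simp only: \<beta>_def cos_arccos)
  define d where "d = (\<Prod>\<mu>\<in>\<Lambda>. [:1, - 1 / \<mu>:])"
  define p where "p = pcompose q [:0, 1 / of_real R:] * d"
  have "degree d \<le> (\<Sum>\<mu>\<in>\<Lambda>. 1)"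
    unfolding d_def by (rule order.trans[OF degree_prod_sum_le[OF fin]]) (rule sum_mono, simp)
  moreover have "degree (pcompose q [:0, 1 / complex_of_real R:]) \<le> m - card \<Lambda>"
    using q(1) R by (simp add: degree_pcompose)
  ultimately have "degree p \<le> m"
    unfolding p_def using degree_mult_le[of "pcompose q [:0, 1 / complex_of_real R:]" d] m by simp
  moreover have "poly p 0 = 1"
    by (simp add: p_def d_def poly_pcompose poly_prod q(2))
  moreover have "poly p \<mu> = 0" if "\<mu> \<in> \<Lambda>" for \<mu>
    using that fin \<Lambda> by (auto simp: p_def d_def poly_prod)
  moreover have "norm (poly p z) \<le> 8 * (2 * sin (\<beta> / (4 - 2 * \<beta> / pi))) ^ (m - card \<Lambda>) *
        (\<Prod>\<mu>\<in>\<Lambda>. 1 / norm \<mu>) * (2 * R) ^ card \<Lambda>" if z: "norm z < R" "Re z > L" for z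
  proof -
    have "norm (poly d z) = (\<Prod>\<mu>\<in>\<Lambda>. norm (1 - z / \<mu>))"
      by (simp add: d_def poly_prod prod_norm)
    also have "\<dots> \<le> (\<Prod>\<mu>\<in>\<Lambda>. 1 / norm \<mu> * (2 * R))"
    proof (intro prod_mono conjI norm_ge_zero)
      fix \<mu> assume \<mu>: "\<mu> \<in> \<Lambda>"
      have "norm (1 - z / \<mu>) = norm (\<mu> - z) / norm \<mu>"
        using \<Lambda>[OF \<mu>] by (simp flip: norm_divide add: diff_divide_distrib)
      also have "\<dots> \<le> (2 * R) / norm \<mu>"
        using \<Lambda>[OF \<mu>] z norm_triangle_ineq4[of \<mu> z] by (intro divide_right_mono) auto
      finally show "norm (1 - z / \<mu>) \<le> 1 / norm \<mu> * (2 * R)" by simp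
    qed
    also have "\<dots> = (\<Prod>\<mu>\<in>\<Lambda>. 1 / norm \<mu>) * (2 * R) ^ card \<Lambda>"
      unfolding prod.distrib by simp
    finally have d: "norm (poly d z) \<le> (\<Prod>\<mu>\<in>\<Lambda>. 1 / norm \<mu>) * (2 * R) ^ card \<Lambda>" .
    have "norm (poly q (z / of_real R)) \<le> 8 * (2 * sin (\<beta> / (4 - 2 * \<beta> / pi))) ^ (m - card \<Lambda>)"
    proof (rule q(3))
      show "norm (z / of_real R) < 1" using z R by (simp add: norm_divide)
      show "cos \<beta> < Re (z / of_real R)"
        using z R by (simp add: cos divide_strict_right_mono)
    qed
    then have "norm (poly q (z / of_real R)) * norm (poly d z) \<le>
        8 * (2 * sin (\<beta> / (4 - 2 * \<beta> / pi))) ^ (m - card \<Lambda>) *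
        ((\<Prod>\<mu>\<in>\<Lambda>. 1 / norm \<mu>) * (2 * R) ^ card \<Lambda>)"
      using d lens_rate[of \<beta>] \<open>0 < \<beta>\<close> \<open>\<beta> < pi / 2\<close> by (intro mult_mono) auto
    then show ?thesis by (simp add: p_def norm_mult poly_pcompose mult.assoc)
  qed
  ultimately show ?thesis by (rule that)
qed

theorem theorem1p3:
  fixes B :: "complex ^ 'n ^ 'n"
    and \<N> :: "complex set"
    and S L0 L1 :: real
  assumes diag: "diagonalisable B"
    and simple: "\<forall>\<mu>\<in>eigenvalues B. simple_eigenvalue B \<mu>"
    and nonsing: "0 \<notin> eigenvalues B"
    and N_open: "open \<N>" and N_bdd: "bounded \<N>" and N_0: "0 \<in> \<N>"
    and S_pos: "S > 0"
    and eigs_in: "eigenvalues B \<subseteq> \<N> \<union> {z. Re z \<ge> S}"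
    and H_nonempty: "\<exists>\<mu>\<in>eigenvalues B. Re \<mu> \<ge> S"
    and L: "0 < L0" "L0 < L1" "L1 \<le> S"
  shows
    "let \<Lambda> = eigenvalues B \<inter> \<N>;
         l = card \<Lambda>;
         n = CARD('n);
         \<kappa> = Max (eig_cond B ` eigenvalues B);
         Neig = card {\<mu>\<in>\<Lambda>. L0 < Re \<mu> \<and> Re \<mu> < L1} + 1;
         \<delta> = (L1 - L0) / (4 * real n * \<kappa> * real Neig);
         nB = spec_norm B;
         \<beta> = arccos (L0 / (nB + \<delta>));
         \<gamma> = 2 * sin (\<beta> / (4 - 2 * \<beta> / pi))
     in \<forall>(b :: complex ^ 'n) x0 m.
          gmres_res_norm B b x0 m / norm (b - B *v x0)
            \<le> (\<Prod>\<mu>\<in>\<Lambda>. 1 / cmod \<mu>) * (nB + \<delta>) ^ (l + 1) * 3 ^ (l + 1) / \<delta>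
               * \<gamma> powr (real m - real l)"
proof -
  define \<Lambda> where "\<Lambda> = eigenvalues B \<inter> \<N>"
  define l where "l = card \<Lambda>"
  define n where "n = CARD('n)"
  define \<kappa> where "\<kappa> = Max (eig_cond B ` eigenvalues B)"
  define Neig where "Neig = card {\<mu>\<in>\<Lambda>. L0 < Re \<mu> \<and> Re \<mu> < L1} + 1"
  define \<delta> where "\<delta> = (L1 - L0) / (4 * real n * \<kappa> * real Neig)"
  define R where "R = spec_norm B + \<delta>"
  define \<beta> where "\<beta> = arccos (L0 / R)"
  define \<gamma> where "\<gamma> = 2 * sin (\<beta> / (4 - 2 * \<beta> / pi))"
  define C where "C = (\<Prod>\<mu>\<in>\<Lambda>. 1 / cmod \<mu>)"
  note poly_bound = poly_krylov_le_eig_cond[OF diag simple, folded \<kappa>_def n_def]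
  have fin: "finite \<Lambda>" using poly_bound(1) by (simp add: \<Lambda>_def)
  have pos: "n > 0" "Neig \<ge> 1" "\<kappa> > 0"
    using poly_bound(2) by (auto simp: n_def Neig_def)
  then have \<delta>: "\<delta> > 0" using L by (simp add: \<delta>_def)
  have eig: "\<mu> \<noteq> 0 \<and> norm \<mu> < R" if "\<mu> \<in> eigenvalues B" for \<mu>
    using eigenvalue_le_spec_norm[OF that] that nonsing \<delta> by (auto simp: R_def)
  obtain \<mu>0 where "\<mu>0 \<in> eigenvalues B" "Re \<mu>0 \<ge> S" using H_nonempty by blast
  then have R: "L1 < R" using eig[of \<mu>0] complex_Re_le_cmod[of \<mu>0] L by linarith
  have \<beta>: "0 < \<beta>" "\<beta> < pi / 2"
    using arccos_acute[of "L0 / R"] R L by (simp_all add: \<beta>_def)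
  have \<gamma>: "0 < \<gamma>" "\<gamma> < 1" using lens_rate[OF \<beta>] by (auto simp: \<gamma>_def)
  have C: "C > 0" unfolding C_def using eig by (intro prod_pos) (auto simp: \<Lambda>_def)
  have n\<kappa>: "real n * \<kappa> \<le> R / (4 * \<delta>)"
  proof -
    \<comment> \<open>The definition of \<delta>, read backwards: it lets
      \<open>1 / \<delta>\<close> absorb the dimension and the condition numbers, using
      \<open>L1 - L0 < R\<close>.\<close>
    have "4 * \<delta> * (real n * \<kappa>) * real Neig = L1 - L0"
      using pos by (simp add: \<delta>_def)
    moreover have "4 * \<delta> * (real n * \<kappa>) * 1 \<le> 4 * \<delta> * (real n * \<kappa>) * real Neig"
      using pos \<delta> by (intro mult_left_mono) auto
    ultimately have "real n * \<kappa> * (4 * \<delta>) \<le> R" using R L by (simp add: mult_ac)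
    then show ?thesis using \<delta> by (simp add: le_divide_eq)
  qed
  have main: "gmres_res_norm B b x0 m / norm (b - B *v x0)
      \<le> C * R ^ (l + 1) * 3 ^ (l + 1) / \<delta> * \<gamma> powr (real m - real l)" for b x0 m
  proof (cases "l \<le> m")
    case True
    obtain p where p: "degree p \<le> m" "poly p 0 = 1" "\<And>\<mu>. \<mu> \<in> \<Lambda> \<Longrightarrow> poly p \<mu> = 0"
      "\<And>z. norm z < R \<Longrightarrow> Re z > L0 \<Longrightarrow> norm (poly p z) \<le> 8 * \<gamma> ^ (m - l) * C * (2 * R) ^ l"
    proof (rule deflated_polynomial[of L0 R \<Lambda> m, folded \<beta>_def, folded \<gamma>_def C_def l_def])
      show "\<mu> \<noteq> 0 \<and> norm \<mu> < R" if "\<mu> \<in> \<Lambda>" for \<mu>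
        using that eig by (auto simp: \<Lambda>_def)
    qed (use L R fin True in auto)
    have "norm (poly p \<mu>) \<le> 8 * \<gamma> ^ (m - l) * C * (2 * R) ^ l" if "\<mu> \<in> eigenvalues B" for \<mu>
    proof (cases "\<mu> \<in> \<Lambda>")
      case True
      then show ?thesis using p(3) \<gamma> C L R by simp
    next
      case False
      then have "Re \<mu> \<ge> S" using that eigs_in by (auto simp: \<Lambda>_def)
      then show ?thesis using L eig[OF that] by (intro p(4)) auto
    qed
    from poly_bound(3)[OF this, of "b - B *v x0"]
    have "gmres_res_norm B b x0 m \<le>
        real n * \<kappa> * (8 * \<gamma> ^ (m - l) * C * (2 * R) ^ l) * norm (b - B *v x0)"
      using gmres_res_norm_le_poly[OF p(1,2), of B b x0] by linarith
    \<comment> \<open>For a zero initial residual the quotient is 0 by the convention on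
      division.\<close>
    then have "gmres_res_norm B b x0 m / norm (b - B *v x0) \<le>
        real n * \<kappa> * (8 * \<gamma> ^ (m - l) * C * (2 * R) ^ l)"
      using pos \<gamma> C L R by (cases "norm (b - B *v x0) = 0") (auto simp: divide_le_eq)
    also have "\<dots> \<le> R / (4 * \<delta>) * (8 * \<gamma> ^ (m - l) * C * (2 * R) ^ l)"
      using n\<kappa> \<gamma> C L R by (intro mult_right_mono) auto
    also have "\<dots> = (C * R ^ (l + 1) / \<delta> * \<gamma> ^ (m - l)) * 2 ^ (l + 1)"
      by (simp add: power_mult_distrib)
    also have "\<dots> \<le> (C * R ^ (l + 1) / \<delta> * \<gamma> ^ (m - l)) * 3 ^ (l + 1)"
      using \<gamma> \<delta> C L R by (intro mult_left_mono power_mono) auto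
    also have "\<gamma> ^ (m - l) = \<gamma> powr (real m - real l)"
      using True \<gamma> by (simp add: powr_realpow flip: of_nat_diff)
    finally show ?thesis by (simp add: mult_ac)
  next
    case False
    \<comment> \<open>With fewer steps than deflated eigenvalues no deflation is possible. The
      polynomial 1 bounds the quotient by 1, while every factor of the claimed bound is at least 1;
      in particular \<gamma> has a negative exponent.\<close>
    have "gmres_res_norm B b x0 m \<le> norm (poly_krylov 1 B (b - B *v x0))"
      by (rule gmres_res_norm_le_poly) auto
    then have "gmres_res_norm B b x0 m / norm (b - B *v x0) \<le> 1"
      by (simp add: poly_krylov_def krylov_vec_def divide_le_eq_1)
    also have "1 \<le> (\<Prod>\<mu>\<in>\<Lambda>. 1 / cmod \<mu> * R) * 3 ^ (l + 1) * (R / \<delta>) * \<gamma> powr (real m - real l)"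
    proof (intro mult_ge1_I)
      show "1 \<le> (\<Prod>\<mu>\<in>\<Lambda>. 1 / cmod \<mu> * R)"
        using eig by (intro prod_ge_1) (auto simp: \<Lambda>_def le_divide_eq less_imp_le)
      have "0 \<le> spec_norm B"
        using eigenvalue_le_spec_norm[OF \<open>\<mu>0 \<in> eigenvalues B\<close>] norm_ge_zero order.trans by blast
      then show "1 \<le> R / \<delta>" using \<delta> by (simp add: R_def le_divide_eq)
      have "\<gamma> powr 0 \<le> \<gamma> powr (real m - real l)"
        using False \<gamma> by (intro powr_mono') auto
      then show "1 \<le> \<gamma> powr (real m - real l)" using \<gamma> by simp
    qed (rule one_le_power, simp)
    also have "(\<Prod>\<mu>\<in>\<Lambda>. 1 / cmod \<mu> * R) = C * R ^ l"
      unfolding C_def l_def prod.distrib by simp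
    finally show ?thesis by (simp add: mult_ac)
  qed
  then show ?thesis
    unfolding Let_def C_def \<gamma>_def \<beta>_def R_def \<delta>_def Neig_def \<kappa>_def n_def l_def \<Lambda>_def by blast
qed

end
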